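(* There exists an absolute constant $C>0$ such that the following holds. Let $n$ be a positive integer, let $D_n$ be a positive integer divisible by $n$ and $E_n$ a positive integer divisible by $2n$, and put $d_n=D_n/n$, $e_n=E_n/(2n)$. Let $L_{n,i},S_{n,i}$ ($i=1,2,3$) be the statistics of random core partitions defined in the context. For any $r>0$ and $i=1,2$, $$\mathbb{P}\big(|L_{n,i}-\mathbb{E}[L_{n,i}]|\ge r\big)\le 2\exp\Big(-C\frac{r^2}{n d_n^2}\Big),\qquad \mathbb{P}\big(|S_{n,i}-\mathbb{E}[S_{n,i}]|\ge r\big)\le 2\exp\Big(-C\frac{r^2}{n^3 d_n^4}\Big).$$ For any $r>0$, $$\mathbb{P}\big(|L_{n,3}-\mathbb{E}[L_{n,3}]|\ge r\big)\le 2\exp\Big(-C\frac{r^2}{n e_n^2}\Big),\qquad \mathbb{P}\big(|S_{n,3}-\mathbb{E}[S_{n,3}]|\ge r\big)\le 2\exp\Big(-C\frac{r^2}{n^3 e_n^4}\Big).$$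
   Context: A partition is a finite non-increasing sequence of positive integers $\lambda=(\lambda_1\ge\cdots\ge\lambda_\ell>0)$; the empty partition is allowed. Its length is $\ell$, its size is $|\lambda|=\sum_i\lambda_i$. It is strict if $\lambda_1>\lambda_2>\cdots>\lambda_\ell$. Its Young diagram is the left-justified array with $\lambda_i$ boxes in row $i$; the hook length of a box is the number of boxes directly to its right or directly below it, plus one for the box itself. The perimeter is the maximal hook length $\lambda_1+\ell-1$ (and is $0$ for the empty partition). The conjugate partition is obtained by exchanging rows and columns of the Young diagram; $\lambda$ is self-conjugate if it equals its conjugate. The length of the Durfee square of $\lambda$ is the largest integer $k$ such that $\lambda$ has at least $k$ parts that are $\ge k$. A partition is an $n$-core if none of its hook lengths is a multiple of $n$. $L_{n,1}$ and $S_{n,1}$ are the length and the size of a uniformly random $n$-core partition with perimeter at most $D_n$. $L_{n,2}$ and $S_{n,2}$ are the length and the size of a uniformly random strict $n$-core partition with perimeter at most $D_n$. $L_{n,3}$ and $S_{n,3}$ are the length of the Durfee square and the size of a uniformly random self-conjugate $n$-core partition with perimeter at most $E_n$. *)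

theory Defs
  imports "HOL-Probability.Probability"
begin

definition is_partition :: "nat list \<Rightarrow> bool" where
  "is_partition p \<longleftrightarrow> sorted_wrt (\<ge>) p \<and> (\<forall>x\<in>set p. x > 0)"

definition strict_partition :: "nat list \<Rightarrow> bool" where
  "strict_partition p \<longleftrightarrow> is_partition p \<and> sorted_wrt (>) p"

text \<open>Rows and columns are numbered from 0; the box \<open>(i, j)\<close> lies in row \<open>i\<close> and column \<open>j\<close>.\<close>

definition young_diagram :: "nat list \<Rightarrow> (nat \<times> nat) set" where
  "young_diagram p = {(i, j). i < length p \<and> j < p ! i}"

definition hook_length :: "nat list \<Rightarrow> nat \<times> nat \<Rightarrow> nat" where
  "hook_length p = (\<lambda>(i, j).
     card {j'. j' > j \<and> (i, j') \<in> young_diagram p} +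
     card {i'. i' > i \<and> (i', j) \<in> young_diagram p} + 1)"

definition is_core :: "nat \<Rightarrow> nat list \<Rightarrow> bool" where
  "is_core n p \<longleftrightarrow> (\<forall>b\<in>young_diagram p. \<not> n dvd hook_length p b)"

definition perimeter :: "nat list \<Rightarrow> nat" where
  "perimeter p = (if p = [] then 0 else Max (hook_length p ` young_diagram p))"

text \<open>The \<open>j\<close>-th part of the conjugate is the number of boxes in column \<open>j\<close>.\<close>

definition conjugate :: "nat list \<Rightarrow> nat list" where
  "conjugate p = map (\<lambda>j. card {i. (i, j) \<in> young_diagram p}) [0..<(if p = [] then 0 else hd p)]"

definition self_conjugate :: "nat list \<Rightarrow> bool" where
  "self_conjugate p \<longleftrightarrow> conjugate p = p"

definition durfee_length :: "nat list \<Rightarrow> nat" where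
  "durfee_length p = (GREATEST k. k \<le> card {i. i < length p \<and> p ! i \<ge> k})"

definition cores :: "nat \<Rightarrow> nat \<Rightarrow> nat list set" where
  "cores n D = {p. is_partition p \<and> is_core n p \<and> perimeter p \<le> D}"

definition strict_cores :: "nat \<Rightarrow> nat \<Rightarrow> nat list set" where
  "strict_cores n D = {p. strict_partition p \<and> is_core n p \<and> perimeter p \<le> D}"

definition self_conjugate_cores :: "nat \<Rightarrow> nat \<Rightarrow> nat list set" where
  "self_conjugate_cores n E =
     {p. is_partition p \<and> self_conjugate p \<and> is_core n p \<and> perimeter p \<le> E}"

text \<open>The probability of \<open>\<bar>X - E[X]\<bar> \<ge> r\<close> for the statistic \<open>X\<close> of a uniformly random element of
  \<open>A\<close>. This requires \<open>A\<close> to be finite and nonempty, which is shown below for the three sets above.\<close>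

definition deviation_prob :: "'a set \<Rightarrow> ('a \<Rightarrow> nat) \<Rightarrow> real \<Rightarrow> real" where
  "deviation_prob A X r = measure_pmf.prob (pmf_of_set A)
     {x. \<bar>real (X x) - measure_pmf.expectation (pmf_of_set A) (\<lambda>y. real (X y))\<bar> \<ge> r}"

lemma partition_antimono:
  assumes "is_partition p" "i \<le> i'" "i' < length p"
  shows "p ! i' \<le> p ! i"
  using assms by (cases "i = i'") (auto simp: is_partition_def sorted_wrt_iff_nth_less)

lemma finite_young_diagram: "finite (young_diagram p)"
proof -
  have "young_diagram p = (SIGMA i:{..<length p}. {..<p ! i})"
    by (auto simp: young_diagram_def)
  then show ?thesis by simp
qed

lemma card_right: "i < length p \<Longrightarrow> card {j'. j' > j \<and> (i, j') \<in> young_diagram p} = p ! i - Suc j"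
proof -
  assume "i < length p"
  then have "{j'. j' > j \<and> (i, j') \<in> young_diagram p} = {Suc j..<p ! i}"
    by (auto simp: young_diagram_def)
  then show ?thesis by simp
qed

lemma perimeter_eq:
  assumes "is_partition p" "p \<noteq> []"
  shows "perimeter p = hd p + length p - 1"
proof -
  have pos: "p ! i > 0" if "i < length p" for i
    using assms that by (auto simp: is_partition_def)
  have 0: "0 < length p" using assms by simp
  have "{i'. i' > 0 \<and> (i', 0) \<in> young_diagram p} = {1..<length p}"
    using pos by (auto simp: young_diagram_def)
  then have h0: "hook_length p (0, 0) = hd p + length p - 1"
    using 0 pos[OF 0] assms by (cases p) (auto simp: hook_length_def card_right)
  have "hook_length p b \<le> hd p + length p - 1" if b: "b \<in> young_diagram p" for b
  proof -
    obtain i j where ij: "b = (i, j)" "i < length p" "j < p ! i"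
      using b by (auto simp: young_diagram_def)
    have "card {i'. i' > i \<and> (i', j) \<in> young_diagram p} \<le> card {Suc i..<length p}"
      by (rule card_mono) (auto simp: young_diagram_def)
    moreover have "p ! i \<le> hd p"
      using partition_antimono[OF assms(1), of 0 i] ij assms by (simp add: hd_conv_nth)
    ultimately show ?thesis using ij by (simp add: hook_length_def card_right)
  qed
  moreover have "(0, 0) \<in> young_diagram p"
    using 0 pos by (simp add: young_diagram_def)
  ultimately have "Max (hook_length p ` young_diagram p) = hd p + length p - 1"
    using h0 by (intro Max_eqI) (auto simp: finite_young_diagram intro: rev_image_eqI)
  then show ?thesis using assms by (simp add: perimeter_def)
qed

lemma young_diagram_conjugate:
  assumes "is_partition p"
  shows "young_diagram (conjugate p) = {(j, i). (i, j) \<in> young_diagram p}"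
proof -
  have "i < card {i. (i, j) \<in> young_diagram p} \<longleftrightarrow> (i, j) \<in> young_diagram p" for i j
  proof
    assume "(i, j) \<in> young_diagram p"
    then have "{..i} \<subseteq> {i. (i, j) \<in> young_diagram p}"
      using partition_antimono[OF assms, of _ i]
      by (fastforce simp: young_diagram_def dest: less_le_trans)
    moreover have "finite {i. (i, j) \<in> young_diagram p}"
      by (rule finite_subset[of _ "{..<length p}"]) (auto simp: young_diagram_def)
    ultimately show "i < card {i. (i, j) \<in> young_diagram p}"
      by (metis card_atMost card_mono Suc_le_eq)
  next
    assume *: "i < card {i. (i, j) \<in> young_diagram p}"
    show "(i, j) \<in> young_diagram p"
    proof (rule ccontr)
      assume n: "(i, j) \<notin> young_diagram p"
      have "{i. (i, j) \<in> young_diagram p} \<subseteq> {..<i}"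
      proof (rule subsetI, rule ccontr)
        fix k assume k: "k \<in> {i. (i, j) \<in> young_diagram p}" "k \<notin> {..<i}"
        then have "i \<le> k" "k < length p" "j < p ! k" by (auto simp: young_diagram_def)
        then have "(i, j) \<in> young_diagram p"
          using partition_antimono[OF assms, of i k] by (simp add: young_diagram_def)
        with n show False by simp
      qed
      then have "card {i. (i, j) \<in> young_diagram p} \<le> i"
        using card_mono[of "{..<i}"] by fastforce
      with * show False by simp
    qed
  qed
  moreover have "p \<noteq> [] \<and> j < hd p" if "(i, j) \<in> young_diagram p" for i j
    using that partition_antimono[OF assms, of 0 i]
    by (cases p) (auto simp: young_diagram_def)
  ultimately show ?thesis
    by (subst (1) young_diagram_def) (auto simp: conjugate_def)
qed

lemma finite_cores: "finite (cores n D)"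
proof (rule finite_subset)
  show "cores n D \<subseteq> {p. set p \<subseteq> {..D} \<and> length p \<le> D}"
  proof safe
    fix p assume l: "p \<in> cores n D"
    then have part: "is_partition p" "perimeter p \<le> D" by (auto simp: cores_def)
    { assume ne: "p \<noteq> []"
      then have "hd p > 0" using part by (simp add: is_partition_def)
      moreover have "0 < length p" using ne by simp
      ultimately have "hd p \<le> D" "length p \<le> D"
        using perimeter_eq[OF part(1) ne] part(2) by linarith+ }
    note * = this
    then show "length p \<le> D" by (cases "p = []") auto
    fix x assume "x \<in> set p"
    then obtain i where i: "i < length p" "x = p ! i" by (auto simp: in_set_conv_nth)
    then have "p \<noteq> []" by auto
    moreover from this have "x \<le> hd p"
      using i partition_antimono[OF part(1), of 0 i] by (simp add: hd_conv_nth)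
    ultimately show "x \<le> D" using * by auto
  qed
  show "finite {p. set p \<subseteq> {..D} \<and> length p \<le> D}"
    by (rule finite_lists_length_le) simp
qed

lemma finite_strict_cores: "finite (strict_cores n D)"
  by (rule finite_subset[OF _ finite_cores[of n D]])
     (auto simp: cores_def strict_cores_def strict_partition_def)

lemma finite_self_conjugate_cores: "finite (self_conjugate_cores n E)"
  by (rule finite_subset[OF _ finite_cores[of n E]])
     (auto simp: cores_def self_conjugate_cores_def)

lemma Nil_in_cores:
  "[] \<in> cores n D" "[] \<in> strict_cores n D" "[] \<in> self_conjugate_cores n E"
  by (auto simp: cores_def strict_cores_def self_conjugate_cores_def strict_partition_def
      is_partition_def is_core_def young_diagram_def perimeter_def self_conjugate_def conjugate_def)

text \<open>The maximum in \<^const>\<open>durfee_length\<close> is attained.\<close>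

lemma durfee_length_greatest:
  "durfee_length p \<le> card {i. i < length p \<and> p ! i \<ge> durfee_length p}"
  "k \<le> card {i. i < length p \<and> p ! i \<ge> k} \<Longrightarrow> k \<le> durfee_length p"
proof -
  let ?P = "\<lambda>k. k \<le> card {i. i < length p \<and> p ! i \<ge> k}"
  have "card {i. i < length p \<and> p ! i \<ge> k} \<le> length p" for k
    using card_mono[of "{..<length p}" "{i. i < length p \<and> p ! i \<ge> k}"] by fastforce
  then have b: "y \<le> length p" if "?P y" for y
    using that le_trans by blast
  show "?P (durfee_length p)"
    unfolding durfee_length_def by (rule GreatestI_nat[of ?P 0, OF _ b]) simp_all
  show "?P k \<Longrightarrow> k \<le> durfee_length p"
    unfolding durfee_length_def by (rule Greatest_le_nat[of ?P k, OF _ b])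
qed

end

theory Submission
  imports Defs "HOL-Probability.Hoeffding"
begin

text \<open>
  The three families of cores are put in bijection with sets of words over a finite alphabet of
  natural numbers, and concentration is proved by a martingale argument on the words, letter by
  letter.

  A partition is determined by the set \<open>H\<close> of hook lengths of its first column
  (\<open>beta\<close>); its length is \<open>card H\<close>, its size is \<open>\<Sum>H - \<Sum>{..<card H}\<close> and, if it is nonempty, its
  perimeter is \<open>Max H\<close>. The partition is an \<open>n\<close>-core iff \<open>H\<close> is closed under subtracting \<open>n\<close> where
  this is possible (\<open>is_core_iff\<close>), and strict iff \<open>H\<close> has no two consecutive elements. Since \<open>0\<close> is
  never in \<open>H\<close>, an \<open>n\<close>-core of perimeter at most \<open>n d\<close> is given by the number, between \<open>0\<close> and \<open>d\<close>,
  of elements of \<open>H\<close> in each nonzero residue class modulo \<open>n\<close>: all words of length \<open>n - 1\<close> over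
  \<open>{0..d}\<close> arise (\<open>beta_image_cores\<close>). Strict cores correspond to the words without two adjacent
  nonzero letters (\<open>beta_image_strict_cores\<close>). For self-conjugate cores the main diagonal hooks
  \<open>2 x + 1\<close> carry the information; for each \<open>r < n div 2\<close> the \<open>x\<close> fill an
  initial segment of at most one of the two residue classes \<open>r\<close> and \<open>n - 1 - r\<close>, with at most \<open>e\<close>
  elements. This again gives all words over an alphabet, here of size \<open>2 e + 1\<close>, and the length of
  the Durfee square is the number of the \<open>x\<close>.

  Without the adjacency condition the letters are independent. Changing one letter moves the length by at most \<open>d\<close> and
  the size by at most a multiple of \<open>n d\<^sup>2\<close>, so Hoeffding's lemma, applied to one letter at a time,
  yields a sub-Gaussian bound with variance proxy of order \<open>n d\<^sup>2\<close> or \<open>n (n d\<^sup>2)\<^sup>2\<close>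
  (\<open>subgaussian_words\<close>), and Markov's inequality finishes the proof. For self-conjugate cores the
  same holds with the Durfee square in place of the length and \<open>e\<close> in place of \<open>d\<close>.

  For strict cores the letters form a Markov chain whose correlation length grows with \<open>d\<close>, so a
  bound on the effect of a letter is not immediate. Compare the continuation \<open>y\<close> after a nonzero
  letter, which must start with \<open>0\<close>, with the continuation \<open>x\<close> after the letter \<open>0\<close>. The two uniform
  continuations can be coupled so that \<open>x = c1 0 c2 0 \<dots> ck 0 z\<close> while \<open>y = 0 c1 0 c2 \<dots> 0 ck z'\<close>
  with the same letters \<open>ci\<close>, until the two words merge, possibly after one more nonzero letter of
  \<open>x\<close> (\<open>coupled\<close>, \<open>mean_blocked_le_separated\<close>). Shifting a letter by one place leaves the length
  unchanged and changes \<open>\<Sum>H\<close> only by the value of the letter, so the total effect stays below the same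
  order \<open>n d\<^sup>2\<close>, with a constant independent of \<open>n\<close> and \<open>d\<close>.
\<close>

section \<open>Sub-Gaussian statistics of a uniformly random element\<close>

text \<open>The average of \<open>f\<close> over a finite set; it is \<open>0\<close> for the empty set.\<close>
definition mean :: "'a set \<Rightarrow> ('a \<Rightarrow> real) \<Rightarrow> real" where
  "mean A f = (\<Sum>x\<in>A. f x) / real (card A)"

text \<open>The value of \<open>f\<close> at a uniformly random element of \<open>A\<close> is sub-Gaussian: the centred moment
  generating function at every real \<open>t\<close> is at most \<open>exp (t\<^sup>2 v)\<close>. The inequality is multiplied by
  \<open>card A\<close>, and \<open>v\<close> is half of the usual variance proxy.\<close>
definition subgaussian :: "'a set \<Rightarrow> ('a \<Rightarrow> real) \<Rightarrow> real \<Rightarrow> bool" where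
  "subgaussian A f v \<longleftrightarrow>
     (\<forall>t. (\<Sum>x\<in>A. exp (t * (f x - mean A f))) \<le> real (card A) * exp (t\<^sup>2 * v))"

lemma sum_eq_card_mean: "finite A \<Longrightarrow> (\<Sum>x\<in>A. f x) = real (card A) * mean A f"
  by (cases "A = {}") (simp_all add: mean_def)

lemma mean_uminus: "mean A (\<lambda>x. - f x) = - mean A f"
  by (simp add: mean_def sum_negf)

lemma mean_add_const: "finite A \<Longrightarrow> A \<noteq> {} \<Longrightarrow> mean A (\<lambda>x. f x + c) = mean A f + c"
  by (simp add: mean_def sum.distrib add_divide_distrib)

lemma mean_image: "inj_on g A \<Longrightarrow> mean (g ` A) f = mean A (\<lambda>x. f (g x))"
  by (simp add: mean_def sum.reindex card_image)

lemma mean_mono: "(\<And>x. x \<in> A \<Longrightarrow> f x \<le> g x) \<Longrightarrow> mean A f \<le> mean A g"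
  unfolding mean_def by (intro divide_right_mono sum_mono) auto

lemma subgaussian_image:
  assumes "inj_on g A"
  shows "subgaussian (g ` A) f v \<longleftrightarrow> subgaussian A (\<lambda>x. f (g x)) v"
  using assms by (simp add: subgaussian_def sum.reindex card_image mean_image)

lemma subgaussian_cong:
  assumes "\<And>x. x \<in> A \<Longrightarrow> f x = g x"
  shows "subgaussian A f v \<longleftrightarrow> subgaussian A g v"
proof -
  have "mean A f = mean A g" using assms by (simp add: mean_def)
  with assms show ?thesis by (simp add: subgaussian_def)
qed

lemma subgaussian_mono:
  assumes "subgaussian A f v" "v \<le> w"
  shows "subgaussian A f w"
  unfolding subgaussian_def
proof
  fix t
  have "(\<Sum>x\<in>A. exp (t * (f x - mean A f))) \<le> real (card A) * exp (t\<^sup>2 * v)"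
    using assms by (simp add: subgaussian_def)
  also have "\<dots> \<le> real (card A) * exp (t\<^sup>2 * w)"
    using assms by (intro mult_left_mono) (auto intro: mult_left_mono)
  finally show "(\<Sum>x\<in>A. exp (t * (f x - mean A f))) \<le> real (card A) * exp (t\<^sup>2 * w)" .
qed

text \<open>Hoeffding's lemma for a function on a finite set with mean \<open>0\<close> and oscillation at most \<open>b\<close>.\<close>
lemma Hoeffding_sum_pos:
  fixes h :: "'a \<Rightarrow> real"
  assumes A: "finite A" "A \<noteq> {}" and t: "t > 0"
    and osc: "\<And>x y. x \<in> A \<Longrightarrow> y \<in> A \<Longrightarrow> h x - h y \<le> b" and zero: "(\<Sum>x\<in>A. h x) = 0"
  shows "(\<Sum>x\<in>A. exp (t * h x)) \<le> real (card A) * exp (t\<^sup>2 * b\<^sup>2 / 8)"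
proof -
  define m where "m = Min (h ` A)"
  have "m \<in> h ` A" unfolding m_def using A by (intro Min_in) auto
  then obtain x0 where x0: "x0 \<in> A" "m = h x0" by auto
  have lo: "m \<le> h x" if "x \<in> A" for x unfolding m_def using A that by auto
  have hi: "h x \<le> m + b" if "x \<in> A" for x using osc[OF that x0(1)] x0 by simp
  interpret interval_bounded_random_variable "measure_pmf (pmf_of_set A)" h m "m + b"
    by unfold_locales (use A lo hi in \<open>auto simp: AE_measure_pmf_iff\<close>)
  have card: "real (card A) > 0" using A by (simp add: card_gt_0_iff)
  have E0: "measure_pmf.expectation (pmf_of_set A) h = 0"
    using A zero by (simp add: integral_pmf_of_set)
  have "nn_integral (pmf_of_set A) (\<lambda>x. ennreal (exp (t * h x))) \<le> ennreal (exp (t\<^sup>2 * b\<^sup>2 / 8))"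
    using Hoeffdings_lemma_nn_integral_0[OF t E0] by simp
  also have "nn_integral (pmf_of_set A) (\<lambda>x. ennreal (exp (t * h x))) =
      ennreal (measure_pmf.expectation (pmf_of_set A) (\<lambda>x. exp (t * h x)))"
    using A by (intro nn_integral_eq_integral integrable_measure_pmf_finite) auto
  finally have "measure_pmf.expectation (pmf_of_set A) (\<lambda>x. exp (t * h x)) \<le> exp (t\<^sup>2 * b\<^sup>2 / 8)"
    by (simp add: ennreal_le_iff)
  then show ?thesis using A card by (simp add: integral_pmf_of_set field_simps)
qed

lemma Hoeffding_sum:
  fixes h :: "'a \<Rightarrow> real"
  assumes A: "finite A" "A \<noteq> {}"
    and osc: "\<And>x y. x \<in> A \<Longrightarrow> y \<in> A \<Longrightarrow> h x - h y \<le> b" and zero: "(\<Sum>x\<in>A. h x) = 0"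
  shows "(\<Sum>x\<in>A. exp (t * h x)) \<le> real (card A) * exp (t\<^sup>2 * b\<^sup>2 / 8)"
proof (cases t "0 :: real" rule: linorder_cases)
  case less
  have "(\<Sum>x\<in>A. exp (- t * - h x)) \<le> real (card A) * exp ((- t)\<^sup>2 * b\<^sup>2 / 8)"
  proof (rule Hoeffding_sum_pos[OF A])
    show "- h x - - h y \<le> b" if "x \<in> A" "y \<in> A" for x y using osc[OF that(2,1)] by simp
  qed (use less zero in \<open>auto simp: sum_negf\<close>)
  then show ?thesis by simp
next
  case greater
  then show ?thesis using Hoeffding_sum_pos[OF A _ osc zero] by simp
qed simp

text \<open>One step of the martingale argument: condition on \<open>\<kappa>\<close>. The conditional means oscillate by at most
  \<open>b\<close>, so Hoeffding's lemma bounds their moment generating function, and the fluctuation inside each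
  fibre is controlled by assumption.\<close>
lemma subgaussian_fibres:
  fixes f :: "'a \<Rightarrow> real" and \<kappa> :: "'a \<Rightarrow> 'b"
  assumes A: "finite A"
    and fib: "\<And>c. c \<in> \<kappa> ` A \<Longrightarrow> subgaussian {x \<in> A. \<kappa> x = c} f v"
    and osc: "\<And>c c'. c \<in> \<kappa> ` A \<Longrightarrow> c' \<in> \<kappa> ` A \<Longrightarrow>
                mean {x \<in> A. \<kappa> x = c} f - mean {x \<in> A. \<kappa> x = c'} f \<le> b"
  shows "subgaussian A f (v + b\<^sup>2 / 8)"
proof (cases "A = {}")
  case False
  define F where "F c = {x \<in> A. \<kappa> x = c}" for c
  define h where "h c = mean (F c) f - mean A f" for c
  have fin: "finite (F c)" for c using A by (simp add: F_def)
  have split: "(\<Sum>x\<in>A. g x) = (\<Sum>c\<in>\<kappa> ` A. \<Sum>x\<in>F c. g x)" for g :: "'a \<Rightarrow> real"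
    unfolding F_def using A by (rule sum.image_gen)
  have const: "(\<Sum>x\<in>F c. g (\<kappa> x)) = real (card (F c)) * g c" for g :: "'b \<Rightarrow> real" and c
    by (simp add: F_def)
  have "(\<Sum>x\<in>A. h (\<kappa> x)) = (\<Sum>c\<in>\<kappa> ` A. real (card (F c)) * h c)"
    by (subst split) (simp add: const)
  also have "\<dots> = (\<Sum>c\<in>\<kappa> ` A. \<Sum>x\<in>F c. f x - mean A f)"
    by (simp add: h_def sum_subtractf sum_eq_card_mean fin algebra_simps)
  also have "\<dots> = (\<Sum>x\<in>A. f x - mean A f)" by (rule split[symmetric])
  also have "\<dots> = 0" using A by (simp add: sum_subtractf sum_eq_card_mean)
  finally have zero: "(\<Sum>x\<in>A. h (\<kappa> x)) = 0" .
  show ?thesis unfolding subgaussian_def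
  proof
    fix t
    have "(\<Sum>x\<in>A. exp (t * (f x - mean A f))) = (\<Sum>c\<in>\<kappa> ` A. \<Sum>x\<in>F c. exp (t * (f x - mean A f)))"
      by (rule split)
    also have "\<dots> = (\<Sum>c\<in>\<kappa> ` A. exp (t * h c) * (\<Sum>x\<in>F c. exp (t * (f x - mean (F c) f))))"
      by (simp add: h_def sum_distrib_left flip: exp_add) (simp add: algebra_simps)
    also have "\<dots> \<le> (\<Sum>c\<in>\<kappa> ` A. exp (t * h c) * (real (card (F c)) * exp (t\<^sup>2 * v)))"
      using fib by (intro sum_mono mult_left_mono) (auto simp: F_def subgaussian_def)
    also have "\<dots> = exp (t\<^sup>2 * v) * (\<Sum>c\<in>\<kappa> ` A. real (card (F c)) * exp (t * h c))"
      by (simp add: sum_distrib_left mult_ac)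
    also have "\<dots> = exp (t\<^sup>2 * v) * (\<Sum>x\<in>A. exp (t * h (\<kappa> x)))"
      by (simp only: split[of "\<lambda>x. exp (t * h (\<kappa> x))"] const[of "\<lambda>c. exp (t * h c)"])
    also have "\<dots> \<le> exp (t\<^sup>2 * v) * (real (card A) * exp (t\<^sup>2 * b\<^sup>2 / 8))"
      using osc by (intro mult_left_mono Hoeffding_sum A False zero) (auto simp: h_def F_def)
    also have "\<dots> = real (card A) * exp (t\<^sup>2 * (v + b\<^sup>2 / 8))"
      by (simp add: algebra_simps exp_add)
    finally show "(\<Sum>x\<in>A. exp (t * (f x - mean A f))) \<le> real (card A) * exp (t\<^sup>2 * (v + b\<^sup>2 / 8))" .
  qed
qed (simp add: subgaussian_def)

text \<open>The Chernoff bound, with the optimal parameter \<open>t = r / (2 v)\<close>.\<close>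
lemma deviation_prob_le:
  fixes X :: "'a \<Rightarrow> nat"
  assumes A: "finite A" "A \<noteq> {}" and sub: "subgaussian A (\<lambda>x. real (X x)) v"
    and v: "v > 0" and r: "r > 0"
  shows "deviation_prob A X r \<le> 2 * exp (- (r\<^sup>2 / (4 * v)))"
proof -
  let ?f = "\<lambda>x. real (X x)"
  let ?m = "mean A ?f"
  have card: "real (card A) > 0" using A by (simp add: card_gt_0_iff)
  define t where "t = r / (2 * v)"
  have t: "t > 0" using v r by (simp add: t_def)
  have tr: "t\<^sup>2 * v - t * r = - (r\<^sup>2 / (4 * v))"
    using v by (simp add: t_def power2_eq_square field_simps)
  have tail: "real (card {x \<in> A. s * (?f x - ?m) \<ge> r}) \<le> real (card A) * exp (- (r\<^sup>2 / (4 * v)))"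
    if s: "s\<^sup>2 = 1" for s :: real
  proof -
    have "real (card {x \<in> A. s * (?f x - ?m) \<ge> r}) * exp (t * r)
        = (\<Sum>x | x \<in> A \<and> s * (?f x - ?m) \<ge> r. exp (t * r))" by simp
    also have "\<dots> \<le> (\<Sum>x | x \<in> A \<and> s * (?f x - ?m) \<ge> r. exp (t * s * (?f x - ?m)))"
      using t by (intro sum_mono) (auto simp: mult.assoc intro: mult_left_mono)
    also have "\<dots> \<le> (\<Sum>x\<in>A. exp (t * s * (?f x - ?m)))"
      using A by (intro sum_mono2) auto
    also have "\<dots> \<le> real (card A) * exp ((t * s)\<^sup>2 * v)"
      using sub unfolding subgaussian_def by blast
    also have "exp ((t * s)\<^sup>2 * v) = exp (- (r\<^sup>2 / (4 * v))) * exp (t * r)"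
    proof -
      have "(t * s)\<^sup>2 * v = - (r\<^sup>2 / (4 * v)) + t * r"
        using s tr by (simp add: power_mult_distrib)
      then show ?thesis by (simp only: exp_add)
    qed
    finally have "real (card {x \<in> A. s * (?f x - ?m) \<ge> r}) * exp (t * r)
        \<le> real (card A) * exp (- (r\<^sup>2 / (4 * v))) * exp (t * r)"
      by (simp only: mult.assoc)
    then show ?thesis by (rule mult_right_le_imp_le) simp
  qed
  define B where "B = {x \<in> A. \<bar>?f x - ?m\<bar> \<ge> r}"
  define B' where "B' s = {x \<in> A. s * (?f x - ?m) \<ge> r}" for s :: real
  have "B \<subseteq> B' 1 \<union> B' (- 1)"
  proof
    fix x assume "x \<in> B"
    then have "x \<in> A" "r \<le> ?f x - ?m \<or> r \<le> - (?f x - ?m)"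
      unfolding B_def by (auto simp only: mem_Collect_eq abs_real_def split: if_splits)
    then show "x \<in> B' 1 \<union> B' (- 1)"
      by (simp only: B'_def Un_iff mem_Collect_eq mult_1_left mult_minus1) blast
  qed
  then have "card B \<le> card (B' 1 \<union> B' (- 1))"
    using A by (intro card_mono) (simp_all add: B'_def)
  also have "\<dots> \<le> card (B' 1) + card (B' (- 1))" by (rule card_Un_le)
  finally have "real (card B) \<le> real (card (B' 1)) + real (card (B' (- 1)))" by linarith
  moreover have "real (card (B' 1)) \<le> real (card A) * exp (- (r\<^sup>2 / (4 * v)))"
    unfolding B'_def by (rule tail) simp
  moreover have "real (card (B' (- 1))) \<le> real (card A) * exp (- (r\<^sup>2 / (4 * v)))"
    unfolding B'_def by (rule tail) simp
  ultimately have "real (card B) \<le> 2 * (real (card A) * exp (- (r\<^sup>2 / (4 * v))))" by linarith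
  also have "\<dots> = 2 * exp (- (r\<^sup>2 / (4 * v))) * real (card A)" by (simp only: mult_ac)
  finally have "real (card B) \<le> 2 * exp (- (r\<^sup>2 / (4 * v))) * real (card A)" .
  then have "real (card B) / real (card A) \<le> 2 * exp (- (r\<^sup>2 / (4 * v)))"
    using card by (simp only: pos_divide_le_eq)
  moreover have "deviation_prob A X r = real (card B) / real (card A)"
    using A unfolding B_def
    by (simp add: deviation_prob_def integral_pmf_of_set measure_pmf_of_set mean_def Int_def)
  ultimately show ?thesis by simp
qed

section \<open>Words: independent letters, and nonzero letters that are never adjacent\<close>

text \<open>Words of length \<open>m\<close> over the alphabet \<open>{0..d}\<close>.\<close>
definition words :: "nat \<Rightarrow> nat \<Rightarrow> nat list set" where
  "words d m = {xs. length xs = m \<and> set xs \<subseteq> {..d}}"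

lemma words_0: "words d 0 = {[]}"
  by (auto simp: words_def)

lemma Cons_in_words_iff: "x # xs \<in> words d (Suc m) \<longleftrightarrow> x \<le> d \<and> xs \<in> words d m"
  by (auto simp: words_def)

lemma Nil_notin_words: "[] \<notin> words d (Suc m)"
  by (simp add: words_def)

lemma finite_words: "finite (words d m)"
  unfolding words_def using finite_lists_length_eq[of "{..d}" m] by (simp add: conj_commute)

lemma words_nonempty: "words d m \<noteq> {}"
proof -
  have "replicate m 0 \<in> words d m" by (auto simp: words_def)
  then show ?thesis by blast
qed

lemma words_fibre: "c \<le> d \<Longrightarrow> {x \<in> words d (Suc m). hd x = c} = (#) c ` words d m"
proof (intro equalityI subsetI)
  fix x assume "c \<le> d" "x \<in> {x \<in> words d (Suc m). hd x = c}"
  then show "x \<in> (#) c ` words d m"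
    by (cases x) (auto simp: Cons_in_words_iff Nil_notin_words)
qed (auto simp: Cons_in_words_iff)

lemma hd_words_le: "x \<in> words d (Suc m) \<Longrightarrow> hd x \<le> d"
  by (cases x) (auto simp: Cons_in_words_iff Nil_notin_words)

lemma mean_diff_le:
  assumes "finite A" "A \<noteq> {}" "\<And>x. x \<in> A \<Longrightarrow> f x - g x \<le> b"
  shows "mean A f - mean A g \<le> b"
proof -
  have "mean A f \<le> mean A (\<lambda>x. g x + b)"
    by (rule mean_mono) (use assms(3) in \<open>force simp: algebra_simps\<close>)
  then show ?thesis using assms by (simp add: mean_add_const)
qed

text \<open>The bounded differences inequality for independent letters.\<close>
lemma subgaussian_words:
  fixes F :: "nat list \<Rightarrow> real"
  assumes "\<And>u c c' w. u @ c # w \<in> words d m \<Longrightarrow> u @ c' # w \<in> words d m \<Longrightarrow>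
             F (u @ c # w) - F (u @ c' # w) \<le> b"
  shows "subgaussian (words d m) F (real m * (b\<^sup>2 / 8))"
  using assms
proof (induction m arbitrary: F)
  case 0
  then show ?case by (simp add: words_0 subgaussian_def mean_def)
next
  case (Suc m)
  have "subgaussian (words d (Suc m)) F (real m * (b\<^sup>2 / 8) + b\<^sup>2 / 8)"
  proof (rule subgaussian_fibres[where \<kappa> = hd])
    fix c assume "c \<in> hd ` words d (Suc m)"
    then have c: "c \<le> d" using hd_words_le by auto
    have "subgaussian (words d m) (\<lambda>x. F (c # x)) (real m * (b\<^sup>2 / 8))"
    proof (rule Suc.IH)
      fix u a a' w assume "u @ a # w \<in> words d m" "u @ a' # w \<in> words d m"
      then show "F (c # u @ a # w) - F (c # u @ a' # w) \<le> b"
        using Suc.prems[of "c # u" a w a'] c by (simp add: Cons_in_words_iff)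
    qed
    then show "subgaussian {x \<in> words d (Suc m). hd x = c} F (real m * (b\<^sup>2 / 8))"
      by (simp add: words_fibre c subgaussian_image)
  next
    fix c c' assume "c \<in> hd ` words d (Suc m)" "c' \<in> hd ` words d (Suc m)"
    then have c: "c \<le> d" "c' \<le> d" using hd_words_le by auto
    have "mean (words d m) (\<lambda>x. F (c # x)) - mean (words d m) (\<lambda>x. F (c' # x)) \<le> b"
      using Suc.prems[of "[]" c _ c'] c
      by (intro mean_diff_le finite_words words_nonempty) (simp add: Cons_in_words_iff)
    then show "mean {x \<in> words d (Suc m). hd x = c} F - mean {x \<in> words d (Suc m). hd x = c'} F \<le> b"
      by (simp add: words_fibre c mean_image)
  qed (rule finite_words)
  moreover have "real (Suc m) * (b\<^sup>2 / 8) = real m * (b\<^sup>2 / 8) + b\<^sup>2 / 8"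
    by (simp add: field_simps)
  ultimately show ?case by (simp only:)
qed

text \<open>No two adjacent letters are both nonzero.\<close>
primrec separated :: "nat list \<Rightarrow> bool" where
  "separated [] \<longleftrightarrow> True"
| "separated (x # xs) \<longleftrightarrow> separated xs \<and> (x = 0 \<or> xs = [] \<or> hd xs = 0)"

text \<open>The separated words of length \<open>m\<close> over \<open>{0..d}\<close>.\<close>
definition separated_words :: "nat \<Rightarrow> nat \<Rightarrow> nat list set" where
  "separated_words d m = {xs \<in> words d m. separated xs}"

text \<open>The separated words that may follow a nonzero letter, including the empty word.\<close>
definition blocked_words :: "nat \<Rightarrow> nat \<Rightarrow> nat list set" where
  "blocked_words d m = {xs \<in> separated_words d m. xs = [] \<or> hd xs = 0}"

lemma separated_words_0: "separated_words d 0 = {[]}"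
  by (auto simp: separated_words_def words_0)

lemma blocked_words_0: "blocked_words d 0 = {[]}"
  by (auto simp: blocked_words_def separated_words_0)

lemma Cons_in_separated_words_iff:
  "x # xs \<in> separated_words d (Suc m) \<longleftrightarrow>
     x \<le> d \<and> xs \<in> separated_words d m \<and> (x = 0 \<or> xs \<in> blocked_words d m)"
  by (auto simp: separated_words_def blocked_words_def Cons_in_words_iff)

lemma Nil_notin_separated_words: "[] \<notin> separated_words d (Suc m)"
  by (simp add: separated_words_def Nil_notin_words)

lemma blocked_words_Suc: "blocked_words d (Suc m) = (#) 0 ` separated_words d m"
proof (intro equalityI subsetI)
  fix x assume "x \<in> blocked_words d (Suc m)"
  then show "x \<in> (#) 0 ` separated_words d m"
    by (cases x) (auto simp: blocked_words_def Cons_in_separated_words_iff Nil_notin_separated_words)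
qed (auto simp: blocked_words_def Cons_in_separated_words_iff)

lemma blocked_subset_separated: "blocked_words d m \<subseteq> separated_words d m"
  by (auto simp: blocked_words_def)

lemma finite_separated_words: "finite (separated_words d m)"
  by (simp add: separated_words_def finite_words)

lemma finite_blocked_words: "finite (blocked_words d m)"
  by (simp add: blocked_words_def finite_separated_words)

lemma replicate_in_blocked_words: "replicate m 0 \<in> blocked_words d m"
proof -
  have "separated (replicate m 0)" by (induction m) auto
  then show ?thesis
    by (cases m) (auto simp: blocked_words_def separated_words_def words_def)
qed

lemma blocked_words_nonempty: "blocked_words d m \<noteq> {}"
  using replicate_in_blocked_words by blast

lemma separated_words_nonempty: "separated_words d m \<noteq> {}"
  using blocked_words_nonempty blocked_subset_separated by blast

lemma separated_fibre_zero: "{x \<in> separated_words d (Suc m). hd x = 0} = (#) 0 ` separated_words d m"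
proof (intro equalityI subsetI)
  fix x assume "x \<in> {x \<in> separated_words d (Suc m). hd x = 0}"
  then show "x \<in> (#) 0 ` separated_words d m"
    by (cases x) (auto simp: Cons_in_separated_words_iff Nil_notin_separated_words)
qed (auto simp: Cons_in_separated_words_iff)

lemma separated_fibre_pos:
  assumes "0 < c" "c \<le> d"
  shows "{x \<in> separated_words d (Suc m). hd x = c} = (#) c ` blocked_words d m"
proof (intro equalityI subsetI)
  fix x assume "x \<in> {x \<in> separated_words d (Suc m). hd x = c}"
  then show "x \<in> (#) c ` blocked_words d m"
    using assms by (cases x) (auto simp: Cons_in_separated_words_iff Nil_notin_separated_words)
qed (use assms in \<open>auto simp: Cons_in_separated_words_iff blocked_subset_separated[THEN subsetD]\<close>)

lemma hd_separated_words_le: "x \<in> separated_words d (Suc m) \<Longrightarrow> hd x \<le> d"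
  by (auto simp: separated_words_def hd_words_le)

lemma sum_separated_words_Suc:
  "(\<Sum>x\<in>separated_words d (Suc m). f x) =
     (\<Sum>x\<in>separated_words d m. f (0 # x)) + (\<Sum>c=1..d. \<Sum>x\<in>blocked_words d m. f (c # x))"
proof -
  have "hd ` separated_words d (Suc m) \<subseteq> {0..d}" using hd_separated_words_le by auto
  then have "(\<Sum>x\<in>separated_words d (Suc m). f x) =
      (\<Sum>c=0..d. \<Sum>x | x \<in> separated_words d (Suc m) \<and> hd x = c. f x)"
    by (intro sum.group[symmetric] finite_separated_words) auto
  also have "\<dots> = (\<Sum>x | x \<in> separated_words d (Suc m) \<and> hd x = 0. f x) +
      (\<Sum>c=1..d. \<Sum>x | x \<in> separated_words d (Suc m) \<and> hd x = c. f x)"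
    by (subst sum.atLeast_Suc_atMost) auto
  also have "(\<Sum>x | x \<in> separated_words d (Suc m) \<and> hd x = 0. f x) = (\<Sum>x\<in>separated_words d m. f (0 # x))"
    by (simp add: separated_fibre_zero sum.reindex)
  also have "(\<Sum>c=1..d. \<Sum>x | x \<in> separated_words d (Suc m) \<and> hd x = c. f x) =
      (\<Sum>c=1..d. \<Sum>x\<in>blocked_words d m. f (c # x))"
  proof (rule sum.cong[OF refl])
    fix c assume "c \<in> {1..d}"
    then show "(\<Sum>x | x \<in> separated_words d (Suc m) \<and> hd x = c. f x) = (\<Sum>x\<in>blocked_words d m. f (c # x))"
      by (subst separated_fibre_pos) (auto simp: sum.reindex)
  qed
  finally show ?thesis .
qed

text \<open>\<open>coupled y x\<close> relates a word \<open>y\<close> that may follow a nonzero letter to a word \<open>x\<close> that follows the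
  letter \<open>0\<close>. Nonzero letters of \<open>y\<close> are those of \<open>x\<close> moved one place to the right, up to the place
  where the words merge; in \<open>coupled_single\<close> and \<open>coupled_merge\<close> the word \<open>x\<close> may have one nonzero letter more.
  The letters in the rules are arbitrary, since only pairs of separated words are ever compared.\<close>
inductive coupled :: "nat list \<Rightarrow> nat list \<Rightarrow> bool" where
  coupled_Nil: "coupled [] []"
| coupled_single: "coupled [0] [c]"
| coupled_zero: "coupled (0 # z) (0 # z)"
| coupled_merge: "coupled (0 # 0 # z) (c # 0 # z)"
| coupled_shift: "coupled y x \<Longrightarrow> coupled (0 # c # y) (c # 0 # x)"

text \<open>There is a coupling of the uniform distributions on the two sets that is supported on the relation
  \<open>coupled\<close>, here expressed through the resulting comparison of means. Write \<open>A m\<close> and \<open>B m\<close> for the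
  sets of separated and of blocked words. A word in \<open>B (m + 2)\<close> is \<open>0 z\<close> with \<open>z\<close> in \<open>A (m + 1)\<close>.
  A word in \<open>A (m + 2)\<close> is either \<open>0 z\<close>, which is paired with the same word of \<open>B (m + 2)\<close>, or \<open>c 0 w\<close>
  with \<open>w\<close> in \<open>A m\<close>; the latter is paired with \<open>0 0 w\<close>, or with \<open>0 c w'\<close> where \<open>w'\<close> in \<open>B m\<close> is coupled to
  \<open>w\<close> by induction. The inequalities \<open>G0\<close>, \<open>U0\<close> and \<open>UT\<close> below correspond to these three cases.\<close>
lemma mean_blocked_le_separated:
  fixes f g :: "nat list \<Rightarrow> real"
  assumes "\<And>y x. y \<in> blocked_words d m \<Longrightarrow> x \<in> separated_words d m \<Longrightarrow> coupled y x \<Longrightarrow> f y \<le> g x"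
  shows "mean (blocked_words d m) f \<le> mean (separated_words d m) g"
  using assms
proof (induction m arbitrary: f g rule: induct_nat_012)
  case 0
  then show ?case
    using coupled_Nil by (simp add: blocked_words_0 separated_words_0 mean_def)
next
  case 1
  have B: "blocked_words d (Suc 0) = {[0]}"
    by (simp add: blocked_words_Suc separated_words_0)
  have "f [0] \<le> g x" if x: "x \<in> separated_words d (Suc 0)" for x
  proof -
    obtain c where "x = [c]" using x by (auto simp: separated_words_def words_def length_Suc_conv)
    then show ?thesis using 1 x coupled_single[of c] by (auto simp: B)
  qed
  then have "mean (separated_words d (Suc 0)) (\<lambda>_. f [0]) \<le> mean (separated_words d (Suc 0)) g"
    by (rule mean_mono)
  moreover have "mean (separated_words d (Suc 0)) (\<lambda>_. f [0]) = f [0]"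
    using finite_separated_words separated_words_nonempty by (simp add: mean_def)
  ultimately show ?case by (simp add: B mean_def)
next
  case (ge2 m)
  let ?A = "separated_words d" and ?B = "blocked_words d"
  define a b a1 where "a = real (card (?A m))" and "b = real (card (?B m))"
    and "a1 = real (card (?A (Suc m)))"
  have pos: "a > 0" "b > 0" "a1 > 0"
    unfolding a_def b_def a1_def
    using finite_separated_words separated_words_nonempty finite_blocked_words blocked_words_nonempty
    by (simp_all add: card_gt_0_iff)
  define S0 where "S0 = (\<Sum>w\<in>?A m. f (0 # 0 # w))"
  define T where "T c = (\<Sum>w\<in>?B m. f (0 # c # w))" for c
  define U where "U c = (\<Sum>w\<in>?A m. g (c # 0 # w))" for c
  define G0 where "G0 = (\<Sum>z\<in>?A (Suc m). g (0 # z))"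
  have a1: "a1 = a + real d * b"
    using sum_separated_words_Suc[of "\<lambda>_. 1 :: real" d m] by (simp add: a1_def a_def b_def)
  have a2: "real (card (?A (Suc (Suc m)))) = a1 + real d * a"
    using sum_separated_words_Suc[of "\<lambda>_. 1 :: real" d "Suc m"]
    by (simp add: a1_def a_def blocked_words_Suc card_image)
  have SB: "(\<Sum>y\<in>?B (Suc (Suc m)). f y) = S0 + (\<Sum>c=1..d. T c)"
    by (simp add: blocked_words_Suc[of d "Suc m"] sum.reindex sum_separated_words_Suc S0_def T_def)
  have SB': "(\<Sum>y\<in>?B (Suc (Suc m)). f y) = (\<Sum>z\<in>?A (Suc m). f (0 # z))"
    by (simp add: blocked_words_Suc[of d "Suc m"] sum.reindex)
  have SA: "(\<Sum>x\<in>?A (Suc (Suc m)). g x) = G0 + (\<Sum>c=1..d. U c)"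
    by (simp add: sum_separated_words_Suc[of g d "Suc m"] blocked_words_Suc sum.reindex G0_def U_def)
  have G0: "S0 + (\<Sum>c=1..d. T c) \<le> G0"
    unfolding SB[symmetric] SB' G0_def
    by (intro sum_mono ge2.prems coupled_zero) (auto simp: blocked_words_Suc Cons_in_separated_words_iff)
  have U0: "S0 \<le> U c" if "c \<in> {1..d}" for c
    unfolding S0_def U_def using that
    by (intro sum_mono ge2.prems coupled_merge)
       (auto simp: blocked_words_Suc Cons_in_separated_words_iff)
  have UT: "a * T c \<le> b * U c" if c: "c \<in> {1..d}" for c
  proof -
    have "mean (?B m) (\<lambda>w. f (0 # c # w)) \<le> mean (?A m) (\<lambda>w. g (c # 0 # w))"
    proof (rule ge2.IH(1))
      fix y x assume yx: "y \<in> ?B m" "x \<in> ?A m" "coupled y x"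
      show "f (0 # c # y) \<le> g (c # 0 # x)"
        using yx c blocked_subset_separated[of d m]
        by (intro ge2.prems coupled_shift) (auto simp: blocked_words_Suc Cons_in_separated_words_iff)
    qed
    then show ?thesis using pos by (simp add: mean_def T_def U_def a_def b_def field_simps)
  qed
  \<comment> \<open>After cross-multiplication by the cardinalities, \<open>U0\<close> enters with weight \<open>a\<close> and \<open>UT\<close> with weight \<open>d\<close>.\<close>
  have "real d * a * (S0 + (\<Sum>c=1..d. T c)) = a * (\<Sum>c=1..d. S0) + real d * (\<Sum>c=1..d. a * T c)"
    by (simp add: algebra_simps sum_distrib_left)
  also have "\<dots> \<le> a * (\<Sum>c=1..d. U c) + real d * (\<Sum>c=1..d. b * U c)"
    using pos U0 UT by (intro add_mono mult_left_mono sum_mono) auto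
  also have "\<dots> = a1 * (\<Sum>c=1..d. U c)"
    by (simp add: a1 algebra_simps sum_distrib_left sum.distrib)
  finally have "(S0 + (\<Sum>c=1..d. T c)) * (a1 + real d * a) \<le> (G0 + (\<Sum>c=1..d. U c)) * a1"
    using mult_left_mono[OF G0, of a1] pos by (simp add: algebra_simps)
  moreover have "real (card (?B (Suc (Suc m)))) = a1"
    by (simp add: blocked_words_Suc[of d "Suc m"] card_image a1_def)
  ultimately show ?case
    unfolding mean_def SB SA a2 using pos
    by (simp add: pos_divide_le_eq pos_le_divide_eq add_pos_nonneg)
qed

lemma abs_mean_blocked_separated_le:
  fixes f g :: "nat list \<Rightarrow> real"
  assumes "\<And>y x. y \<in> blocked_words d m \<Longrightarrow> x \<in> separated_words d m \<Longrightarrow> coupled y x \<Longrightarrow> \<bar>f y - g x\<bar> \<le> b"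
  shows "\<bar>mean (blocked_words d m) f - mean (separated_words d m) g\<bar> \<le> b"
proof -
  have "mean (blocked_words d m) f \<le> mean (separated_words d m) (\<lambda>x. g x + b)"
    by (rule mean_blocked_le_separated) (use assms in \<open>force simp: abs_le_iff\<close>)
  moreover have "mean (blocked_words d m) (\<lambda>y. - f y) \<le> mean (separated_words d m) (\<lambda>x. - g x + b)"
    by (rule mean_blocked_le_separated) (use assms in \<open>force simp: abs_le_iff\<close>)
  moreover have "mean (separated_words d m) (\<lambda>x. h x + b) = mean (separated_words d m) h + b" for h
    by (rule mean_add_const[OF finite_separated_words separated_words_nonempty])
  ultimately show ?thesis by (simp only: mean_uminus abs_le_iff) linarith
qed

text \<open>The bounded differences inequality for separated words. Besides the effect of changing one
  letter, the difference between continuing after \<open>0\<close> and after \<open>c\<close> along coupled words must be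
  bounded.\<close>
lemma subgaussian_separated_words:
  fixes F :: "nat list \<Rightarrow> real"
  assumes "\<And>u c c' w. u @ c # w \<in> separated_words d m \<Longrightarrow> u @ c' # w \<in> separated_words d m \<Longrightarrow>
             F (u @ c # w) - F (u @ c' # w) \<le> b"
    and "\<And>u c x y. u @ 0 # x \<in> separated_words d m \<Longrightarrow> u @ c # y \<in> separated_words d m \<Longrightarrow>
             coupled y x \<Longrightarrow> \<bar>F (u @ c # y) - F (u @ 0 # x)\<bar> \<le> b"
  shows "subgaussian (separated_words d m) F (real m * (b\<^sup>2 / 8))"
  using assms
proof (induction m arbitrary: F rule: less_induct)
  case (less m)
  note lip = less.prems(1) and cpl = less.prems(2)
  show ?case
  proof (cases m)
    case 0
    then show ?thesis by (simp add: separated_words_0 subgaussian_def mean_def)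
  next
    case m: (Suc m')
    let ?v = "real m' * (b\<^sup>2 / 8)"
    have zero: "subgaussian (separated_words d m') (\<lambda>x. F (0 # x)) ?v"
    proof (rule less.IH)
      fix u c c' w assume "u @ c # w \<in> separated_words d m'" "u @ c' # w \<in> separated_words d m'"
      then show "F (0 # u @ c # w) - F (0 # u @ c' # w) \<le> b"
        using lip[of "0 # u" c w c'] by (simp add: m Cons_in_separated_words_iff)
    next
      fix u c x y assume "u @ 0 # x \<in> separated_words d m'" "u @ c # y \<in> separated_words d m'" "coupled y x"
      then show "\<bar>F (0 # u @ c # y) - F (0 # u @ 0 # x)\<bar> \<le> b"
        using cpl[of "0 # u" x c y] by (simp add: m Cons_in_separated_words_iff)
    qed (simp add: m)
    have pos: "subgaussian (blocked_words d m') (\<lambda>x. F (a # x)) ?v" if a: "a \<le> d" for a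
    proof (cases m')
      case 0
      then show ?thesis by (simp add: blocked_words_0 subgaussian_def mean_def)
    next
      case m': (Suc k)
      have in_iff: "a # 0 # z \<in> separated_words d m \<longleftrightarrow> z \<in> separated_words d k" for z
        using a by (auto simp: m m' Cons_in_separated_words_iff blocked_words_Suc)
      have "subgaussian (separated_words d k) (\<lambda>x. F (a # 0 # x)) (real k * (b\<^sup>2 / 8))"
      proof (rule less.IH)
        fix u c c' w assume "u @ c # w \<in> separated_words d k" "u @ c' # w \<in> separated_words d k"
        then show "F (a # 0 # u @ c # w) - F (a # 0 # u @ c' # w) \<le> b"
          using lip[of "a # 0 # u" c w c'] by (simp add: in_iff)
      next
        fix u c x y assume "u @ 0 # x \<in> separated_words d k" "u @ c # y \<in> separated_words d k" "coupled y x"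
        then show "\<bar>F (a # 0 # u @ c # y) - F (a # 0 # u @ 0 # x)\<bar> \<le> b"
          using cpl[of "a # 0 # u" x c y] by (simp add: in_iff)
      qed (simp add: m m')
      then have "subgaussian (separated_words d k) (\<lambda>x. F (a # 0 # x)) ?v"
        by (rule subgaussian_mono) (simp add: m' algebra_simps)
      then show ?thesis by (simp add: m' blocked_words_Suc subgaussian_image)
    qed
    have free_blocked: "\<bar>mean (blocked_words d m') (\<lambda>y. F (a # y))
        - mean (separated_words d m') (\<lambda>x. F (0 # x))\<bar> \<le> b" if a: "a \<le> d" for a
    proof (rule abs_mean_blocked_separated_le)
      fix y x assume "y \<in> blocked_words d m'" "x \<in> separated_words d m'" "coupled y x"
      then show "\<bar>F (a # y) - F (0 # x)\<bar> \<le> b"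
        using cpl[of "[]" x a y] a blocked_subset_separated[of d m']
        by (auto simp: m Cons_in_separated_words_iff)
    qed
    have blocked_blocked: "mean (blocked_words d m') (\<lambda>y. F (a # y))
        - mean (blocked_words d m') (\<lambda>y. F (a' # y)) \<le> b" if a: "a \<le> d" "a' \<le> d" for a a'
    proof (rule mean_diff_le)
      fix y assume "y \<in> blocked_words d m'"
      then show "F (a # y) - F (a' # y) \<le> b"
        using lip[of "[]" a y a'] a blocked_subset_separated[of d m']
        by (auto simp: m Cons_in_separated_words_iff)
    qed (simp_all add: finite_blocked_words blocked_words_nonempty)
    have b: "0 \<le> b" using free_blocked[of 0] by linarith
    have fibre: "{x \<in> separated_words d (Suc m'). hd x = c} =
        (#) c ` (if c = 0 then separated_words d m' else blocked_words d m')" if "c \<le> d" for c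
      using that by (simp add: separated_fibre_zero separated_fibre_pos)
    have "subgaussian (separated_words d (Suc m')) F (?v + b\<^sup>2 / 8)"
    proof (rule subgaussian_fibres[where \<kappa> = hd])
      fix c assume "c \<in> hd ` separated_words d (Suc m')"
      then have "c \<le> d" using hd_separated_words_le by auto
      then show "subgaussian {x \<in> separated_words d (Suc m'). hd x = c} F ?v"
        using zero pos by (simp add: fibre subgaussian_image)
    next
      fix c c' assume "c \<in> hd ` separated_words d (Suc m')" "c' \<in> hd ` separated_words d (Suc m')"
      then have "c \<le> d" "c' \<le> d" using hd_separated_words_le by auto
      then show "mean {x \<in> separated_words d (Suc m'). hd x = c} F
          - mean {x \<in> separated_words d (Suc m'). hd x = c'} F \<le> b"
        using free_blocked[of c] free_blocked[of c'] blocked_blocked[of c c'] b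
        by (auto simp: fibre mean_image abs_le_iff)
    qed (rule finite_separated_words)
    moreover have "real (Suc m') * (b\<^sup>2 / 8) = ?v + b\<^sup>2 / 8"
      by (simp add: field_simps)
    ultimately show ?thesis by (simp only: m)
  qed
qed

section \<open>First-column hook lengths\<close>

lemma down_closed_eq_lessThan:
  fixes K :: "nat set"
  assumes fin: "finite K" and down: "\<And>k. Suc k \<in> K \<Longrightarrow> k \<in> K"
  shows "K = {..<card K}"
proof -
  have le: "j \<in> K" if "k \<in> K" "j \<le> k" for j k
    using that(2,1) by (induction rule: inc_induct) (auto intro: down)
  have "{..k} \<subseteq> K" if "k \<in> K" for k using le[OF that] by auto
  then have lt: "k < card K" if "k \<in> K" for k
    using card_mono[OF fin, of "{..k}"] that by fastforce
  then have "K \<subseteq> {..<card K}" by auto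
  then show ?thesis by (rule card_subset_eq[rotated]) simp_all
qed

text \<open>The set of hook lengths in the first column of a partition \<open>p\<close>. The row \<open>i\<close> contributes
  \<open>p ! i + (length p - 1 - i)\<close>, see \<open>beta_eq_image\<close> below.\<close>
primrec beta :: "nat list \<Rightarrow> nat set" where
  "beta [] = {}"
| "beta (x # q) = insert (x + length q) (beta q)"

lemma is_partition_Cons_iff:
  "is_partition (x # q) \<longleftrightarrow> is_partition q \<and> 0 < x \<and> (q = [] \<or> hd q \<le> x)"
  by (cases q) (auto simp: is_partition_def intro: le_trans)

lemma is_partition_Nil: "is_partition []"
  by (simp add: is_partition_def)

lemma beta_eq_image: "beta p = (\<lambda>i. p ! i + (length p - 1 - i)) ` {..<length p}"
proof (induction p)
  case (Cons x q)
  have "{..<length (x # q)} = insert 0 (Suc ` {..<length q})"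
    by (simp add: lessThan_Suc_eq_insert_0)
  then show ?case using Cons by (auto simp: image_image)
qed simp

lemma finite_beta: "finite (beta p)"
  by (induction p) auto

lemma beta_less: "is_partition p \<Longrightarrow> z \<in> beta p \<Longrightarrow> z < hd p + length p"
  by (induction p arbitrary: z) (force simp: is_partition_Cons_iff)+

lemma beta_less_Cons: "is_partition (x # q) \<Longrightarrow> z \<in> beta q \<Longrightarrow> z < x + length q"
  using beta_less[of q z] by (cases "q = []") (auto simp: is_partition_Cons_iff)

lemma zero_notin_beta: "is_partition p \<Longrightarrow> 0 \<notin> beta p"
  by (induction p) (auto simp: is_partition_Cons_iff)

lemma max_in_beta: "p \<noteq> [] \<Longrightarrow> hd p + length p - 1 \<in> beta p"
  by (cases p) auto

lemma card_beta: "is_partition p \<Longrightarrow> card (beta p) = length p"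
proof (induction p)
  case (Cons x q)
  then have "x + length q \<notin> beta q" using beta_less_Cons by blast
  then show ?case using Cons by (simp add: finite_beta is_partition_Cons_iff)
qed simp

lemma sum_beta: "is_partition p \<Longrightarrow> \<Sum>(beta p) = sum_list p + \<Sum>{..<length p}"
proof (induction p)
  case (Cons x q)
  then have "x + length q \<notin> beta q" using beta_less_Cons by blast
  then show ?case using Cons by (simp add: finite_beta is_partition_Cons_iff)
qed simp

lemma perimeter_le_iff:
  assumes "is_partition p"
  shows "perimeter p \<le> D \<longleftrightarrow> beta p \<subseteq> {..D}"
proof (cases "p = []")
  case True
  then show ?thesis by (simp add: perimeter_def)
next
  case False
  have "beta p \<subseteq> {..D} \<longleftrightarrow> hd p + length p - 1 \<le> D"
  proof
    assume "beta p \<subseteq> {..D}"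
    then show "hd p + length p - 1 \<le> D" using max_in_beta[OF False] by blast
  next
    assume "hd p + length p - 1 \<le> D"
    then show "beta p \<subseteq> {..D}" using beta_less[OF assms] by fastforce
  qed
  then show ?thesis using perimeter_eq[OF assms False] by simp
qed

lemma inj_on_beta: "inj_on beta {p. is_partition p}"
proof -
  have "p = q" if "is_partition p" "is_partition q" "beta p = beta q" for p q
    using that
  proof (induction p arbitrary: q)
    case Nil
    then show ?case by (cases q) auto
  next
    case (Cons x p)
    then obtain y q' where q: "q = y # q'" by (cases q) auto
    have lens: "length p = length q'"
      using Cons.prems card_beta[of "x # p"] card_beta[of q] by (simp add: q)
    have lt: "z < x + length p" if "z \<in> beta p" for z using beta_less_Cons Cons.prems(1) that by blast
    have lt': "z < y + length q'" if "z \<in> beta q'" for z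
      using beta_less_Cons Cons.prems(2) that q by blast
    have "x + length p \<in> beta q" "y + length q' \<in> beta (x # p)"
      using Cons.prems(3) q by auto
    then have "x + length p = y + length q'"
      using lt lt' q by (fastforce simp: q)
    moreover from this have "beta p = beta q'"
    proof -
      have "x + length p \<notin> beta p" "x + length p \<notin> beta q'"
        using lt lt' \<open>x + length p = y + length q'\<close> by fastforce+
      moreover have "insert (x + length p) (beta p) = insert (x + length p) (beta q')"
        using Cons.prems(3) \<open>x + length p = y + length q'\<close> by (simp add: q)
      ultimately show ?thesis by (metis insert_ident)
    qed
    moreover have "is_partition p" "is_partition q'"
      using Cons.prems q by (auto simp: is_partition_Cons_iff)
    ultimately have "p = q'" "x = y" using Cons.IH[of q'] lens by simp_all
    then show ?case by (simp add: q)
  qed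
  then show ?thesis by (auto simp: inj_on_def)
qed

lemma ex_partition_beta:
  assumes "finite H" "0 \<notin> H"
  shows "\<exists>p. is_partition p \<and> beta p = H"
  using assms
proof (induction H rule: finite_linorder_max_induct)
  case empty
  then show ?case using is_partition_Nil by (intro exI[of _ "[]"]) simp
next
  case (insert b A)
  then obtain q where q: "is_partition q" "beta q = A" by auto
  have "length q < b \<and> (q = [] \<or> hd q + length q \<le> b)"
  proof (cases "q = []")
    case True
    then show ?thesis using insert.prems by auto
  next
    case False
    then have "hd q + length q - 1 < b" using insert.hyps q max_in_beta by blast
    moreover have "0 < hd q" using q False by (cases q) (auto simp: is_partition_Cons_iff)
    ultimately show ?thesis using False by linarith
  qed
  then have "is_partition ((b - length q) # q) \<and> beta ((b - length q) # q) = insert b A"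
    using q by (auto simp: is_partition_Cons_iff)
  then show ?case by blast
qed

lemma strict_partition_iff:
  assumes "is_partition p"
  shows "strict_partition p \<longleftrightarrow> (\<forall>z\<in>beta p. Suc z \<notin> beta p)"
proof -
  have "sorted_wrt (>) p \<longleftrightarrow> (\<forall>z\<in>beta p. Suc z \<notin> beta p)"
    using assms
  proof (induction p)
    case (Cons x q)
    have q: "is_partition q" using Cons.prems by (simp add: is_partition_Cons_iff)
    have "sorted_wrt (>) (x # q) \<longleftrightarrow> sorted_wrt (>) q \<and> (q = [] \<or> hd q < x)"
      using Cons.prems by (cases q) auto
    moreover have "(\<forall>z\<in>beta (x # q). Suc z \<notin> beta (x # q)) \<longleftrightarrow>
        (\<forall>z\<in>beta q. Suc z \<notin> beta q) \<and> (\<forall>z\<in>beta q. Suc z \<noteq> x + length q)"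
      using beta_less_Cons[OF Cons.prems] by fastforce
    moreover have "(\<forall>z\<in>beta q. Suc z \<noteq> x + length q) \<longleftrightarrow> q = [] \<or> hd q < x"
    proof (cases "q = []")
      case False
      have "hd q \<le> x" using Cons.prems False by (simp add: is_partition_Cons_iff)
      then show ?thesis
        using max_in_beta[OF False] beta_less[OF q] False by (fastforce simp: Suc_diff_Suc)
    qed simp
    ultimately show ?case using Cons.IH[OF q] by blast
  qed simp
  then show ?thesis using assms by (simp add: strict_partition_def)
qed

lemma length_conjugate: "p \<noteq> [] \<Longrightarrow> length (conjugate p) = hd p"
  by (simp add: conjugate_def)

lemma less_conjugate_iff:
  assumes "is_partition p" "p \<noteq> []" "j < hd p"
  shows "i < conjugate p ! j \<longleftrightarrow> i < length p \<and> j < p ! i"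
proof -
  have "(j, i) \<in> young_diagram (conjugate p) \<longleftrightarrow> (i, j) \<in> young_diagram p"
    using young_diagram_conjugate[OF assms(1)] by auto
  then show ?thesis using assms by (simp add: young_diagram_def length_conjugate)
qed

lemma nth_le_hd: "is_partition p \<Longrightarrow> i < length p \<Longrightarrow> p ! i \<le> hd p"
  using partition_antimono[of p 0 i] by (cases p) auto

text \<open>For the columns \<open>j < p ! i\<close> of row \<open>i\<close>, the numbers \<open>gap p j\<close> are exactly the nonnegative integers below the
  first-column hook length \<open>h\<close> of row \<open>i\<close> that are not first-column hook lengths (\<open>gap_image\<close>), and the
  hook length of the box \<open>(i, j)\<close> is \<open>h - gap p j\<close> (\<open>hook_length_eq\<close>).\<close>
definition gap :: "nat list \<Rightarrow> nat \<Rightarrow> nat" where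
  "gap p j = length p - conjugate p ! j + j"

lemma conjugate_le_length:
  assumes "is_partition p" "p \<noteq> []" "j < hd p"
  shows "conjugate p ! j \<le> length p"
proof (rule ccontr)
  assume "\<not> conjugate p ! j \<le> length p"
  then show False using less_conjugate_iff[OF assms, of "length p"] by simp
qed

lemma hook_length_eq:
  assumes p: "is_partition p" and i: "i < length p" and j: "j < p ! i"
  shows "hook_length p (i, j) + gap p j = p ! i + (length p - 1 - i)"
proof -
  have ne: "p \<noteq> []" and jh: "j < hd p" using i j nth_le_hd[OF p i] by auto
  have "{i'. i' > i \<and> (i', j) \<in> young_diagram p} = {i<..<conjugate p ! j}"
    unfolding young_diagram_def set_eq_iff mem_Collect_eq greaterThanLessThan_iff prod.case
    by (simp add: less_conjugate_iff[OF p ne jh])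
  moreover have "i < conjugate p ! j" using less_conjugate_iff[OF p ne jh] i j by simp
  moreover have "conjugate p ! j \<le> length p" by (rule conjugate_le_length[OF p ne jh])
  ultimately show ?thesis using i j by (simp add: hook_length_def card_right gap_def)
qed

lemma strict_mono_gap:
  assumes p: "is_partition p" "p \<noteq> []" and j: "j < j'" "j' < hd p"
  shows "gap p j < gap p j'"
proof -
  have "conjugate p ! j' \<le> conjugate p ! j"
  proof (rule ccontr)
    assume "\<not> ?thesis"
    then have "conjugate p ! j < conjugate p ! j'" by simp
    then show False
      using less_conjugate_iff[OF p j(2), of "conjugate p ! j"]
        less_conjugate_iff[OF p, of j "conjugate p ! j"] j by simp
  qed
  then show ?thesis using j conjugate_le_length[OF p, of j] by (simp add: gap_def)
qed

lemma gap_notin_beta: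
  assumes p: "is_partition p" "p \<noteq> []" and j: "j < hd p"
  shows "gap p j \<notin> beta p"
proof
  assume "gap p j \<in> beta p"
  then obtain i where i: "i < length p" "gap p j = p ! i + (length p - 1 - i)"
    by (auto simp: beta_eq_image)
  show False
  proof (cases "j < p ! i")
    case True
    then have "0 < hook_length p (i, j)" by (simp add: hook_length_def)
    with hook_length_eq[OF p(1) i(1) True] i show False by simp
  next
    case False
    then have "conjugate p ! j \<le> i" using less_conjugate_iff[OF p j, of i] by simp
    then show False using False i by (simp add: gap_def)
  qed
qed

lemma gap_image:
  assumes p: "is_partition p" and i: "i < length p"
  shows "gap p ` {..<p ! i} = {..<p ! i + (length p - 1 - i)} - beta p"
proof (rule card_subset_eq)
  \<comment> \<open>One inclusion is immediate, and both sides have \<open>p ! i\<close> elements.\<close>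
  have ne: "p \<noteq> []" using i by auto
  let ?h = "\<lambda>i. p ! i + (length p - 1 - i)"
  have less_hd: "j < hd p" if "j < p ! i" for j using that nth_le_hd[OF p i] by simp
  have "gap p j < ?h i" if "j < p ! i" for j
    using hook_length_eq[OF p i that] by (simp add: hook_length_def)
  then show "gap p ` {..<p ! i} \<subseteq> {..<?h i} - beta p"
    using gap_notin_beta[OF p ne] less_hd by auto
  have "inj_on (gap p) {..<p ! i}"
    by (rule linorder_inj_onI') (use strict_mono_gap[OF p ne] less_hd in fastforce)
  then have "card (gap p ` {..<p ! i}) = p ! i" by (simp add: card_image)
  moreover have "card ({..<?h i} - beta p) = p ! i"
  proof -
    have mono: "?h k < ?h k'" if "k' < k" "k < length p" for k k'
      using partition_antimono[OF p, of k' k] that by simp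
    have "?h k < ?h i \<longleftrightarrow> i < k" if "k < length p" for k
      using mono[of i k] mono[of k i] that i by (cases i k rule: linorder_cases) auto
    then have "{..<?h i} \<inter> beta p = ?h ` {i<..<length p}"
      by (auto simp: beta_eq_image)
    moreover have "inj_on ?h {i<..<length p}"
      by (rule linorder_inj_onI') (use mono in fastforce)
    ultimately have "card ({..<?h i} \<inter> beta p) = card {i<..<length p}"
      by (simp only: card_image)
    then show ?thesis using i by (simp add: card_Diff_subset_Int finite_beta)
  qed
  ultimately show "card (gap p ` {..<p ! i}) = card ({..<?h i} - beta p)" by simp
qed simp

text \<open>By \<open>hook_length_eq\<close> and \<open>gap_image\<close>, the hook lengths in the row with first-column hook length \<open>h\<close> are the
  differences \<open>h - y\<close> with \<open>y < h\<close> outside \<open>beta p\<close>.\<close>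
lemma is_core_iff:
  assumes p: "is_partition p" and n: "n > 0"
  shows "is_core n p \<longleftrightarrow> (\<forall>h\<in>beta p. n \<le> h \<longrightarrow> h - n \<in> beta p)"
proof
  assume core: "is_core n p"
  show "\<forall>h\<in>beta p. n \<le> h \<longrightarrow> h - n \<in> beta p"
  proof (intro ballI impI, rule ccontr)
    fix h assume h: "h \<in> beta p" "n \<le> h" "h - n \<notin> beta p"
    then obtain i where i: "i < length p" "h = p ! i + (length p - 1 - i)"
      by (auto simp: beta_eq_image)
    have "h - n \<in> gap p ` {..<p ! i}"
      using h n unfolding gap_image[OF p i(1)] i(2)[symmetric] by simp
    then obtain j where j: "j < p ! i" "gap p j = h - n" by auto
    have "hook_length p (i, j) = n" using hook_length_eq[OF p i(1) j(1)] i(2) j(2) h(2) by simp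
    moreover have "(i, j) \<in> young_diagram p" using i j by (simp add: young_diagram_def)
    ultimately show False using core by (auto simp: is_core_def)
  qed
next
  assume closed: "\<forall>h\<in>beta p. n \<le> h \<longrightarrow> h - n \<in> beta p"
  have sub: "h - k * n \<in> beta p" if "h \<in> beta p" "k * n \<le> h" for h k
    using that(2)
  proof (induction k)
    case (Suc k)
    then have "h - k * n \<in> beta p" "n \<le> h - k * n" by auto
    then have "h - k * n - n \<in> beta p" using closed by blast
    then show ?case by (simp add: add.commute)
  qed (use that in simp)
  show "is_core n p"
    unfolding is_core_def
  proof (intro ballI notI)
    fix b assume "b \<in> young_diagram p" "n dvd hook_length p b"
    then obtain i j k where ij: "b = (i, j)" "i < length p" "j < p ! i" "hook_length p (i, j) = k * n"
      by (auto simp: young_diagram_def elim!: dvdE) (metis mult.commute)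
    have "gap p j = p ! i + (length p - 1 - i) - k * n" "k * n \<le> p ! i + (length p - 1 - i)"
      using hook_length_eq[OF p ij(2,3)] ij(4) by simp_all
    moreover have "p ! i + (length p - 1 - i) \<in> beta p" using ij by (auto simp: beta_eq_image)
    ultimately have "gap p j \<in> beta p" using sub by simp
    moreover have "p \<noteq> []" "j < hd p" using ij nth_le_hd[OF p ij(2)] by auto
    ultimately show False using gap_notin_beta[OF p] by blast
  qed
qed

lemma is_partition_conjugate:
  assumes p: "is_partition p" "p \<noteq> []"
  shows "is_partition (conjugate p)"
proof -
  have "conjugate p ! j' \<le> conjugate p ! j" if "j < j'" "j' < hd p" for j j'
  proof (rule ccontr)
    assume "\<not> ?thesis"
    then have "conjugate p ! j < conjugate p ! j'" by simp
    then show False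
      using less_conjugate_iff[OF p that(2), of "conjugate p ! j"]
        less_conjugate_iff[OF p, of j "conjugate p ! j"] that by simp
  qed
  moreover have "0 < conjugate p ! j" if "j < hd p" for j
    using less_conjugate_iff[OF p that, of 0] p that by (simp add: hd_conv_nth)
  ultimately show ?thesis
    using p by (auto simp: is_partition_def sorted_wrt_iff_nth_less length_conjugate in_set_conv_nth)
qed

text \<open>Conjugation reflects \<open>{0..M}\<close>, for the perimeter \<open>M\<close>, and exchanges members with non-members.\<close>
lemma beta_conjugate:
  assumes p: "is_partition p" "p \<noteq> []"
  defines "M \<equiv> hd p + length p - 1"
  shows "beta (conjugate p) = (\<lambda>y. M - y) ` ({..<M} - beta p)"
proof -
  have first: "hd p = p ! 0" using p by (simp add: hd_conv_nth)
  have "beta (conjugate p) = (\<lambda>j. conjugate p ! j + (hd p - 1 - j)) ` {..<hd p}"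
    by (simp add: beta_eq_image length_conjugate p)
  also have "\<dots> = (\<lambda>j. M - gap p j) ` {..<hd p}"
  proof (rule image_cong[OF refl])
    fix j assume "j \<in> {..<hd p}"
    then show "conjugate p ! j + (hd p - 1 - j) = M - gap p j"
      using conjugate_le_length[OF p, of j] by (simp add: gap_def M_def)
  qed
  also have "\<dots> = (\<lambda>y. M - y) ` gap p ` {..<p ! 0}" by (simp add: image_image first)
  also have "gap p ` {..<p ! 0} = {..<M} - beta p"
  proof -
    have "p ! 0 + (length p - 1 - 0) = M" using p by (cases p) (simp_all add: M_def)
    then show ?thesis using gap_image[OF p(1), of 0] p by simp
  qed
  finally show ?thesis .
qed

lemma self_conjugate_iff:
  assumes p: "is_partition p"
  shows "self_conjugate p \<longleftrightarrow>
    beta p \<subseteq> {..<2 * length p} \<and> (\<forall>z<2 * length p. z \<in> beta p \<longleftrightarrow> 2 * length p - 1 - z \<notin> beta p)"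
proof (cases "p = []")
  case True
  then show ?thesis by (simp add: self_conjugate_def conjugate_def)
next
  case ne: False
  define M where "M = hd p + length p - 1"
  have M: "M \<in> beta p" unfolding M_def by (rule max_in_beta[OF ne])
  have M0: "M > 0" using M zero_notin_beta[OF p] by (cases M) auto
  have le_M: "z \<le> M" if "z \<in> beta p" for z using beta_less[OF p that] by (simp add: M_def)
  have sc: "self_conjugate p \<longleftrightarrow> beta p = (\<lambda>y. M - y) ` ({..<M} - beta p)"
    using inj_onD[OF inj_on_beta, of "conjugate p" p] p ne is_partition_conjugate[OF p ne]
      beta_conjugate[OF p ne]
    by (auto simp: self_conjugate_def M_def)
  show ?thesis
  proof
    assume "self_conjugate p"
    then have "conjugate p = p" by (simp add: self_conjugate_def)
    then have "hd p = length p" using length_conjugate[OF ne] by simp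
    then have len_M: "M = 2 * length p - 1" "2 * length p = Suc M" using M0 by (simp_all add: M_def)
    have eq: "beta p = (\<lambda>y. M - y) ` ({..<M} - beta p)" using \<open>self_conjugate p\<close> sc by simp
    have sym: "z \<in> beta p \<longleftrightarrow> M - z \<notin> beta p" if z: "z \<le> M" for z
    proof
      assume "z \<in> beta p"
      then obtain y where "y < M" "y \<notin> beta p" "z = M - y" using eq by auto
      then show "M - z \<notin> beta p" by simp
    next
      assume nz: "M - z \<notin> beta p"
      show "z \<in> beta p"
      proof (cases "z = 0")
        case True
        then show ?thesis using nz M by simp
      next
        case False
        then have "M - (M - z) \<in> (\<lambda>y. M - y) ` ({..<M} - beta p)"
          using nz z by (intro imageI) auto
        then show ?thesis using eq z by simp
      qed
    qed
    have "beta p \<subseteq> {..<2 * length p}" using le_M unfolding len_M(2) by (auto simp: less_Suc_eq_le)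
    moreover have "z \<in> beta p \<longleftrightarrow> 2 * length p - 1 - z \<notin> beta p" if "z < 2 * length p" for z
      unfolding len_M(1)[symmetric] by (rule sym) (use that len_M(2) in simp)
    ultimately show "beta p \<subseteq> {..<2 * length p} \<and>
        (\<forall>z<2 * length p. z \<in> beta p \<longleftrightarrow> 2 * length p - 1 - z \<notin> beta p)" by blast
  next
    assume H: "beta p \<subseteq> {..<2 * length p} \<and>
        (\<forall>z<2 * length p. z \<in> beta p \<longleftrightarrow> 2 * length p - 1 - z \<notin> beta p)"
    have "0 < 2 * length p" using ne by simp
    then have "2 * length p - 1 \<in> beta p" using H zero_notin_beta[OF p] by (metis diff_zero)
    then have "2 * length p - 1 \<le> M" by (rule le_M)
    moreover have "M < 2 * length p" using H M by auto
    ultimately have len_M: "2 * length p = Suc M" by simp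
    have sym: "z \<in> beta p \<longleftrightarrow> M - z \<notin> beta p" if "z \<le> M" for z
    proof -
      have "z < 2 * length p" "2 * length p - 1 - z = M - z" using that len_M by simp_all
      then show ?thesis using H by metis
    qed
    have "beta p = (\<lambda>y. M - y) ` ({..<M} - beta p)"
    proof (intro equalityI subsetI)
      fix z assume z: "z \<in> beta p"
      then have "z \<le> M" "z \<noteq> 0" using le_M zero_notin_beta[OF p] by (blast, metis)
      moreover have "M - z \<notin> beta p" using sym[OF \<open>z \<le> M\<close>] z by blast
      ultimately show "z \<in> (\<lambda>y. M - y) ` ({..<M} - beta p)"
        by (intro image_eqI[of _ _ "M - z"]) auto
    next
      fix z assume "z \<in> (\<lambda>y. M - y) ` ({..<M} - beta p)"
      then obtain y where "y < M" "y \<notin> beta p" "z = M - y" by auto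
      then show "z \<in> beta p" using sym[of y] by auto
    qed
    then show "self_conjugate p" using sc by simp
  qed
qed

text \<open>The Durfee square has as many rows as there are boxes \<open>(i, i)\<close> on the diagonal, and row \<open>i\<close> reaches the
  diagonal iff its first-column hook length is at least \<open>length p\<close>.\<close>
lemma durfee_length_eq:
  assumes p: "is_partition p"
  shows "durfee_length p = card {z \<in> beta p. length p \<le> z}"
proof -
  define I where "I = {i. i < length p \<and> i < p ! i}"
  have finI: "finite I" by (rule finite_subset[of _ "{..<length p}"]) (auto simp: I_def)
  have I: "I = {..<card I}"
  proof (rule down_closed_eq_lessThan[OF finI])
    fix k assume "Suc k \<in> I"
    then show "k \<in> I" using partition_antimono[OF p, of k "Suc k"] by (auto simp: I_def)
  qed
  have "{z \<in> beta p. length p \<le> z} = (\<lambda>i. p ! i + (length p - 1 - i)) ` I"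
    by (auto simp: beta_eq_image I_def)
  moreover have "inj_on (\<lambda>i. p ! i + (length p - 1 - i)) I"
  proof (rule linorder_inj_onI')
    fix i j assume "i \<in> I" "j \<in> I" "i < j"
    then show "p ! i + (length p - 1 - i) \<noteq> p ! j + (length p - 1 - j)"
      using partition_antimono[OF p, of i j] by (auto simp: I_def)
  qed
  ultimately have card: "card {z \<in> beta p. length p \<le> z} = card I" by (simp add: card_image)
  let ?J = "\<lambda>k. {i. i < length p \<and> p ! i \<ge> k}"
  have finJ: "finite (?J k)" for k by (rule finite_subset[of _ "{..<length p}"]) auto
  have "card I \<le> durfee_length p"
  proof (rule durfee_length_greatest(2))
    have "{..<card I} \<subseteq> ?J (card I)"
    proof
      fix i assume i: "i \<in> {..<card I}"
      then have "card I - 1 \<in> {..<card I}" by auto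
      then have "card I - 1 \<in> I" by (subst I)
      then have "card I - 1 < length p" "card I - 1 < p ! (card I - 1)" by (auto simp only: I_def)
      then show "i \<in> ?J (card I)"
        using partition_antimono[OF p, of i "card I - 1"] i by simp linarith
    qed
    then have "card {..<card I} \<le> card (?J (card I))" by (rule card_mono[OF finJ])
    then show "card I \<le> card (?J (card I))" by (simp only: card_lessThan)
  qed
  moreover have "durfee_length p \<le> card I"
  proof -
    let ?k = "durfee_length p"
    have J: "?J ?k = {..<card (?J ?k)}"
    proof (rule down_closed_eq_lessThan[OF finJ])
      fix k assume "Suc k \<in> ?J ?k"
      then show "k \<in> ?J ?k" using partition_antimono[OF p, of k "Suc k"] by auto
    qed
    have "{..<?k} \<subseteq> ?J ?k"
      using durfee_length_greatest(1)[of p] by (subst J) auto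
    then have "{..<?k} \<subseteq> I" by (auto simp: I_def)
    then have "card {..<?k} \<le> card I" by (rule card_mono[OF finI])
    then show ?thesis by (simp only: card_lessThan)
  qed
  ultimately show ?thesis using card by simp
qed

section \<open>Cores and strict cores as words\<close>

text \<open>The first \<open>c\<close> natural numbers congruent to \<open>j\<close> modulo \<open>n\<close>, for \<open>j < n\<close>.\<close>
definition prog :: "nat \<Rightarrow> nat \<Rightarrow> nat \<Rightarrow> nat set" where
  "prog n j c = {x. x mod n = j \<and> x div n < c}"

lemma prog_eq_image: "j < n \<Longrightarrow> prog n j c = (\<lambda>k. j + n * k) ` {..<c}"
proof (intro equalityI subsetI)
  fix x assume "x \<in> prog n j c"
  then have "x = j + n * (x div n)" "x div n \<in> {..<c}" by (auto simp: prog_def)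
  then show "x \<in> (\<lambda>k. j + n * k) ` {..<c}" by (rule image_eqI)
qed (auto simp: prog_def)

lemma inj_on_prog: "(j::nat) < n \<Longrightarrow> inj_on (\<lambda>k. j + n * k) A"
  by (auto simp: inj_on_def)

lemma finite_prog: "j < n \<Longrightarrow> finite (prog n j c)"
  by (simp add: prog_eq_image)

lemma card_prog: "j < n \<Longrightarrow> card (prog n j c) = c"
  by (simp add: prog_eq_image card_image inj_on_prog)

lemma sum_prog: "j < n \<Longrightarrow> \<Sum>(prog n j c) = (\<Sum>k<c. j + n * k)"
  by (simp add: prog_eq_image sum.reindex inj_on_prog)

lemma prog_less: "0 < n \<Longrightarrow> x \<in> prog n j c \<Longrightarrow> x < n * c"
  by (auto simp: prog_def div_less_iff_less_mult mult.commute)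

text \<open>The union of the sets \<open>Q (j + i) (xs ! i)\<close> over the positions \<open>i\<close> of the word \<open>xs\<close>, and the
  corresponding sum of \<open>W (j + i) (xs ! i)\<close>.\<close>
primrec union_along :: "(nat \<Rightarrow> nat \<Rightarrow> nat set) \<Rightarrow> nat \<Rightarrow> nat list \<Rightarrow> nat set" where
  "union_along Q j [] = {}"
| "union_along Q j (c # xs) = Q j c \<union> union_along Q (Suc j) xs"

primrec sum_along :: "(nat \<Rightarrow> nat \<Rightarrow> nat) \<Rightarrow> nat \<Rightarrow> nat list \<Rightarrow> nat" where
  "sum_along W j [] = 0"
| "sum_along W j (c # xs) = W j c + sum_along W (Suc j) xs"

lemma union_along_iff: "x \<in> union_along Q j xs \<longleftrightarrow> (\<exists>i<length xs. x \<in> Q (j + i) (xs ! i))"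
proof (induction xs arbitrary: j)
  case (Cons c xs)
  have "(\<exists>i<length (c # xs). x \<in> Q (j + i) ((c # xs) ! i)) \<longleftrightarrow>
      x \<in> Q j c \<or> (\<exists>i<length xs. x \<in> Q (j + Suc i) (xs ! i))"
    by (simp add: Ex_less_Suc2)
  then show ?case using Cons by simp
qed simp

lemma finite_union_along:
  assumes "\<And>i c. j \<le> i \<Longrightarrow> i < j + length xs \<Longrightarrow> finite (Q i c)"
  shows "finite (union_along Q j xs)"
  using assms by (induction xs arbitrary: j) auto

lemma sum_union_along:
  assumes "\<And>i c. j \<le> i \<Longrightarrow> i < j + length xs \<Longrightarrow> finite (Q i c)"
    and "\<And>i i' c c'. j \<le> i \<Longrightarrow> i < i' \<Longrightarrow> i' < j + length xs \<Longrightarrow> Q i c \<inter> Q i' c' = {}"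
  shows "(\<Sum>x\<in>union_along Q j xs. f x) = sum_along (\<lambda>i c. \<Sum>x\<in>Q i c. f x) j xs"
  using assms
proof (induction xs arbitrary: j)
  case (Cons c xs)
  have "Q j c \<inter> union_along Q (Suc j) xs = {}"
  proof -
    have "x \<notin> union_along Q (Suc j) xs" if "x \<in> Q j c" for x
    proof
      assume "x \<in> union_along Q (Suc j) xs"
      then obtain i where "i < length xs" "x \<in> Q (Suc j + i) (xs ! i)" by (auto simp: union_along_iff)
      then show False using that Cons.prems(2)[of j "Suc j + i" c "xs ! i"] by auto
    qed
    then show ?thesis by blast
  qed
  moreover have "finite (Q j c)" using Cons.prems(1) by simp
  moreover have "finite (union_along Q (Suc j) xs)" by (rule finite_union_along) (use Cons.prems(1) in simp)
  moreover have "(\<Sum>x\<in>union_along Q (Suc j) xs. f x) = sum_along (\<lambda>i c. \<Sum>x\<in>Q i c. f x) (Suc j) xs"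
    by (rule Cons.IH) (use Cons.prems in simp_all)
  ultimately show ?case by (simp add: sum.union_disjoint)
qed simp

lemma sum_along_cong:
  assumes "\<And>i c. j \<le> i \<Longrightarrow> i < j + length xs \<Longrightarrow> W i c = W' i c"
  shows "sum_along W j xs = sum_along W' j xs"
  using assms by (induction xs arbitrary: j) auto

lemma sum_along_append: "sum_along W j (u @ v) = sum_along W j u + sum_along W (j + length u) v"
  by (induction u arbitrary: j) auto

lemma sum_along_const: "sum_along (\<lambda>_ c. c) j xs = sum_list xs"
  by (induction xs arbitrary: j) auto

text \<open>The number of elements of \<open>H\<close> in the residue class of \<open>r\<close>, for \<open>r < n\<close>. If \<open>H\<close> is closed under
  subtracting \<open>n\<close>, these counts determine \<open>H\<close>.\<close>
definition runner :: "nat \<Rightarrow> nat set \<Rightarrow> nat \<Rightarrow> nat" where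
  "runner n H r = card {k. r + n * k \<in> H}"

lemma runner_iff:
  assumes n: "n > 0" and fin: "finite H" and closed: "\<And>h. h \<in> H \<Longrightarrow> n \<le> h \<Longrightarrow> h - n \<in> H"
  shows "x \<in> H \<longleftrightarrow> x div n < runner n H (x mod n)"
proof -
  let ?K = "{k. x mod n + n * k \<in> H}"
  have "?K = {..<card ?K}"
  proof (rule down_closed_eq_lessThan)
    have "(\<lambda>k. x mod n + n * k) ` ?K \<subseteq> H" by auto
    then have "finite ((\<lambda>k. x mod n + n * k) ` ?K)" using fin by (rule finite_subset)
    then show "finite ?K" by (rule finite_imageD) (use n in \<open>auto simp: inj_on_def\<close>)
  next
    fix k assume "Suc k \<in> ?K"
    then show "k \<in> ?K" using closed[of "x mod n + n * Suc k"] by simp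
  qed
  then have "x div n \<in> ?K \<longleftrightarrow> x div n < card ?K" by blast
  then show ?thesis by (simp add: runner_def)
qed

text \<open>The set whose number of elements in the residue class of \<open>i + 1\<close> is \<open>xs ! i\<close>, as small as
  possible in each class. The class of \<open>0\<close> is left empty.\<close>
definition beads :: "nat \<Rightarrow> nat list \<Rightarrow> nat set" where
  "beads n xs = union_along (prog n) 1 xs"

lemma beads_iff:
  assumes "length xs = n - 1"
  shows "x \<in> beads n xs \<longleftrightarrow> x mod n \<noteq> 0 \<and> n > 0 \<and> x div n < xs ! (x mod n - 1)"
proof
  assume "x \<in> beads n xs"
  then show "x mod n \<noteq> 0 \<and> n > 0 \<and> x div n < xs ! (x mod n - 1)"
    using assms by (auto simp: beads_def union_along_iff prog_def)
next
  assume *: "x mod n \<noteq> 0 \<and> n > 0 \<and> x div n < xs ! (x mod n - 1)"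
  then have "x mod n < n" by simp
  then have "x mod n - 1 < length xs" using * assms by linarith
  then show "x \<in> beads n xs" using * by (auto simp: beads_def union_along_iff prog_def intro!: exI[of _ "x mod n - 1"])
qed

lemma finite_beads: "length xs = n - 1 \<Longrightarrow> finite (beads n xs)"
  unfolding beads_def by (rule finite_union_along) (auto intro: finite_prog)

lemma beads_nth_iff:
  assumes "length xs = n - 1" "i < n - 1"
  shows "Suc i + n * k \<in> beads n xs \<longleftrightarrow> k < xs ! i"
proof -
  have "Suc i < n" using assms by simp
  then have "(Suc i + n * k) mod n = Suc i" "(Suc i + n * k) div n = k"
    using div_mult_self2[of n "Suc i" k] mod_mult_self2[of "Suc i" k n] by simp_all
  then show ?thesis using assms by (subst beads_iff) auto
qed

lemma inj_on_beads: "inj_on (beads n) {xs. length xs = n - 1}"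
proof (rule inj_onI)
  fix xs ys assume xy: "xs \<in> {xs. length xs = n - 1}" "ys \<in> {xs. length xs = n - 1}"
    "beads n xs = beads n ys"
  have "xs ! i = ys ! i" if i: "i < n - 1" for i
  proof -
    have "k < xs ! i \<longleftrightarrow> k < ys ! i" for k
      using beads_nth_iff[of xs n i k] beads_nth_iff[of ys n i k] xy i by simp
    then show ?thesis by (metis linorder_neqE_nat less_irrefl)
  qed
  then show "xs = ys" using xy by (intro nth_equalityI) auto
qed

lemma words_nth_le: "xs \<in> words d m \<Longrightarrow> i < m \<Longrightarrow> xs ! i \<le> d"
  by (auto simp: words_def subset_iff)

lemma beta_image_cores:
  assumes n: "n > 0"
  shows "beta ` cores n (n * d) = beads n ` words d (n - 1)"
proof (intro equalityI subsetI)
  fix H assume "H \<in> beta ` cores n (n * d)"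
  then obtain p where p: "is_partition p" "is_core n p" "perimeter p \<le> n * d" "H = beta p"
    by (auto simp: cores_def)
  have closed: "h - n \<in> H" if "h \<in> H" "n \<le> h" for h
    using that p is_core_iff[OF p(1) n] by auto
  note mem = runner_iff[OF n, of H, OF _ closed]
  have fin: "finite H" using p finite_beta by simp
  have bound: "H \<subseteq> {..n * d}" using p perimeter_le_iff by simp
  have no0: "0 \<notin> H" using p zero_notin_beta by simp
  have run0: "runner n H 0 = 0" using mem[of 0, OF fin] no0 n by simp
  define xs where "xs = map (\<lambda>i. runner n H (Suc i)) [0..<n - 1]"
  have "runner n H j \<le> d" if j: "0 < j" "j < n" for j
  proof (rule ccontr)
    assume "\<not> runner n H j \<le> d"
    then have "j + n * d \<in> H" using mem[of "j + n * d", OF fin] j by simp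
    then show False using bound j by auto
  qed
  then have "xs \<in> words d (n - 1)" by (auto simp: words_def xs_def)
  moreover have "H = beads n xs"
  proof (rule set_eqI)
    fix x
    have "x mod n < n" using n by simp
    then have "xs ! (x mod n - 1) = runner n H (x mod n)" if "x mod n \<noteq> 0"
    proof -
      have "x mod n - 1 < n - 1" using that \<open>x mod n < n\<close> by linarith
      then show ?thesis using that by (simp add: xs_def)
    qed
    then show "x \<in> H \<longleftrightarrow> x \<in> beads n xs"
      using run0 n mem[of x, OF fin] beads_iff[of xs n x] by (cases "x mod n = 0") (auto simp: xs_def)
  qed
  ultimately show "H \<in> beads n ` words d (n - 1)" by blast
next
  fix H assume "H \<in> beads n ` words d (n - 1)"
  then obtain xs where xs: "xs \<in> words d (n - 1)" "H = beads n xs" by blast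
  have len: "length xs = n - 1" using xs by (simp add: words_def)
  have fin: "finite H" using xs finite_beads[OF len] by simp
  have no0: "0 \<notin> H" using xs beads_iff[OF len, of 0] by simp
  obtain p where p: "is_partition p" "beta p = H" using ex_partition_beta[OF fin no0] by blast
  have "h - n \<in> H" if h: "h \<in> H" "n \<le> h" for h
  proof -
    have "(h - n) mod n = h mod n" "(h - n) div n \<le> h div n"
      using h by (auto simp: le_mod_geq intro: div_le_mono)
    then show ?thesis using h xs beads_iff[OF len, of h] beads_iff[OF len, of "h - n"] by auto
  qed
  then have "is_core n p" using is_core_iff[OF p(1) n] p by auto
  moreover have "H \<subseteq> {..n * d}"
  proof
    fix x assume "x \<in> H"
    then obtain i where i: "i < length xs" "x \<in> prog n (1 + i) (xs ! i)"
      using xs by (auto simp: beads_def union_along_iff)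
    have "xs ! i \<le> d" using words_nth_le[OF xs(1)] i len by simp
    then have "n * (xs ! i) \<le> n * d" by simp
    then have "x \<le> n * d" using prog_less[OF n i(2)] by linarith
    then show "x \<in> {..n * d}" by simp
  qed
  ultimately have "p \<in> cores n (n * d)" using p perimeter_le_iff[OF p(1)] by (simp add: cores_def)
  then show "H \<in> beta ` cores n (n * d)" using p by blast
qed

lemma separated_iff_nth: "separated xs \<longleftrightarrow> (\<forall>i<length xs - 1. xs ! i = 0 \<or> xs ! Suc i = 0)"
proof (induction xs)
  case (Cons x xs)
  then show ?case by (cases xs) (auto simp: All_less_Suc2)
qed simp

text \<open>The class of \<open>0\<close> is empty, so consecutive elements lie in adjacent classes \<open>i\<close> and \<open>i + 1\<close> with
  \<open>i > 0\<close>; conversely, if both classes are nonempty they contain \<open>i\<close> and \<open>i + 1\<close>.\<close>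
lemma beads_no_consecutive_iff:
  assumes len: "length xs = n - 1"
  shows "(\<forall>z\<in>beads n xs. Suc z \<notin> beads n xs) \<longleftrightarrow> separated xs"
proof
  assume nc: "\<forall>z\<in>beads n xs. Suc z \<notin> beads n xs"
  have "xs ! i = 0 \<or> xs ! Suc i = 0" if i: "i < length xs - 1" for i
  proof -
    have "i < n - 1" "Suc i < n - 1" using i len by simp_all
    then have "Suc i \<in> beads n xs \<longleftrightarrow> 0 < xs ! i" "Suc (Suc i) \<in> beads n xs \<longleftrightarrow> 0 < xs ! Suc i"
      using beads_nth_iff[OF len, of i 0] beads_nth_iff[OF len, of "Suc i" 0] by simp_all
    then show ?thesis using nc by blast
  qed
  then show "separated xs" by (simp add: separated_iff_nth)
next
  assume sp: "separated xs"
  show "\<forall>z\<in>beads n xs. Suc z \<notin> beads n xs"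
  proof (intro ballI notI)
    fix z assume z: "z \<in> beads n xs" "Suc z \<in> beads n xs"
    have *: "Suc z mod n = Suc (z mod n)"
      using z beads_iff[OF len, of "Suc z"] by (auto simp: mod_Suc split: if_splits)
    have n: "n > 0" and pos: "0 < z mod n" "0 < xs ! (z mod n - 1)" "0 < xs ! (z mod n)"
      using z beads_iff[OF len, of z] beads_iff[OF len, of "Suc z"] * by auto
    have "Suc z mod n < n" using n by simp
    then have "z mod n - 1 < length xs - 1" using * pos len by linarith
    then have "xs ! (z mod n - 1) = 0 \<or> xs ! Suc (z mod n - 1) = 0" using sp by (simp add: separated_iff_nth)
    then show False using pos by simp
  qed
qed

lemma strict_cores_eq: "strict_cores n D = {p \<in> cores n D. strict_partition p}"
  by (auto simp: strict_cores_def cores_def strict_partition_def)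

lemma beta_image_strict_cores:
  assumes n: "n > 0"
  shows "beta ` strict_cores n (n * d) = beads n ` separated_words d (n - 1)"
proof -
  have "beta ` strict_cores n (n * d) = {H \<in> beta ` cores n (n * d). \<forall>z\<in>H. Suc z \<notin> H}"
    by (auto simp: strict_cores_eq cores_def strict_partition_iff)
  also have "\<dots> = beads n ` {xs \<in> words d (n - 1). \<forall>z\<in>beads n xs. Suc z \<notin> beads n xs}"
    unfolding beta_image_cores[OF n] by blast
  also have "{xs \<in> words d (n - 1). \<forall>z\<in>beads n xs. Suc z \<notin> beads n xs} = separated_words d (n - 1)"
    unfolding separated_words_def
    by (intro Collect_cong conj_cong refl beads_no_consecutive_iff) (simp add: words_def)
  finally show ?thesis .
qed

section \<open>Self-conjugate cores as words\<close>

text \<open>For self-conjugate \<open>p\<close>, the numbers \<open>x\<close> such that \<open>2 x + 1\<close> is a hook length on the main diagonal, that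
  is, \<open>x\<close> is the arm length of a diagonal box.\<close>
definition diag :: "nat list \<Rightarrow> nat set" where
  "diag p = {x. length p + x \<in> beta p}"

lemma finite_diag: "finite (diag p)"
proof -
  have "(+) (length p) ` diag p \<subseteq> beta p" by (auto simp: diag_def)
  then have "finite ((+) (length p) ` diag p)" using finite_beta by (rule finite_subset)
  then show ?thesis by (rule finite_imageD) simp
qed

lemma durfee_length_eq_card_diag: "is_partition p \<Longrightarrow> durfee_length p = card (diag p)"
proof -
  assume p: "is_partition p"
  have "{z \<in> beta p. length p \<le> z} = (+) (length p) ` diag p"
    by (auto simp: diag_def image_iff le_iff_add)
  then show ?thesis using durfee_length_eq[OF p] by (simp add: card_image)
qed

lemma diag_less_length:
  assumes p: "is_partition p" "self_conjugate p" and x: "x \<in> diag p"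
  shows "x < length p"
proof -
  have "beta p \<subseteq> {..<2 * length p}" using self_conjugate_iff[OF p(1)] p(2) by simp
  then show ?thesis using x by (auto simp: diag_def)
qed

text \<open>The first-column hook lengths of the self-conjugate partition with diagonal arm lengths \<open>P\<close> and
  length \<open>l\<close>: of the two numbers \<open>l + x\<close> and \<open>l - 1 - x\<close>, which the reflection of \<open>{0..<2 l}\<close> exchanges,
  exactly one is taken.\<close>
definition unfold_diag :: "nat \<Rightarrow> nat set \<Rightarrow> nat set" where
  "unfold_diag l P = (\<lambda>x. if x \<in> P then l + x else l - 1 - x) ` {..<l}"

lemma unfold_diag_iff:
  assumes "P \<subseteq> {..<l}"
  shows "z \<in> unfold_diag l P \<longleftrightarrow> (if l \<le> z then z - l \<in> P else l - 1 - z \<notin> P)"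
proof (cases "l \<le> z")
  case True
  have "z \<in> unfold_diag l P \<longleftrightarrow> z - l \<in> P"
  proof
    assume "z - l \<in> P"
    moreover from this have "z - l < l" using assms by auto
    ultimately show "z \<in> unfold_diag l P"
      using True unfolding unfold_diag_def by (intro image_eqI[of _ _ "z - l"]) auto
  qed (use True in \<open>auto simp: unfold_diag_def split: if_splits\<close>)
  then show ?thesis using True by simp
next
  case False
  have "z \<in> unfold_diag l P \<longleftrightarrow> l - 1 - z \<notin> P"
  proof
    assume "l - 1 - z \<notin> P"
    then show "z \<in> unfold_diag l P"
      using False unfolding unfold_diag_def by (intro image_eqI[of _ _ "l - 1 - z"]) auto
  qed (use False in \<open>auto simp: unfold_diag_def split: if_splits\<close>)
  then show ?thesis using False by simp
qed

lemma inj_on_unfold_diag_map: "inj_on (\<lambda>x. if x \<in> P then l + x else l - 1 - x) {..<l :: nat}"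
  by (auto simp: inj_on_def split: if_splits)

lemma card_unfold_diag: "card (unfold_diag l P) = l"
  unfolding unfold_diag_def card_image[OF inj_on_unfold_diag_map] by simp

lemma sum_unfold_diag:
  assumes "P \<subseteq> {..<l}"
  shows "\<Sum>(unfold_diag l P) = \<Sum>{..<l} + (\<Sum>x\<in>P. 2 * x + 1)"
proof -
  have "\<Sum>(unfold_diag l P) = (\<Sum>x<l. if x \<in> P then l + x else l - 1 - x)"
    unfolding unfold_diag_def sum.reindex[OF inj_on_unfold_diag_map] o_def ..
  also have "\<dots> = (\<Sum>x<l. (l - 1 - x) + (if x \<in> P then 2 * x + 1 else 0))"
    by (rule sum.cong) auto
  also have "\<dots> = (\<Sum>x<l. l - 1 - x) + (\<Sum>x<l. if x \<in> P then 2 * x + 1 else 0)"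
    by (rule sum.distrib)
  also have "(\<Sum>x<l. l - 1 - x) = \<Sum>{..<l}"
    using sum.nat_diff_reindex[of "\<lambda>x. x" l] by simp
  also have "(\<Sum>x<l. if x \<in> P then 2 * x + 1 else 0) = (\<Sum>x\<in>{..<l} \<inter> P. 2 * x + 1)"
    by (simp only: sum.inter_restrict[OF finite_lessThan])
  also have "{..<l} \<inter> P = P" using assms by blast
  finally show ?thesis .
qed

lemma beta_eq_unfold_diag:
  assumes p: "is_partition p" "self_conjugate p"
  shows "beta p = unfold_diag (length p) (diag p)"
proof (rule set_eqI)
  fix z
  let ?l = "length p"
  have sub: "diag p \<subseteq> {..<?l}" using diag_less_length[OF p] by auto
  have sym: "w \<in> beta p \<longleftrightarrow> 2 * ?l - 1 - w \<notin> beta p" if "w < 2 * ?l" for w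
    using self_conjugate_iff[OF p(1)] p(2) that by blast
  show "z \<in> beta p \<longleftrightarrow> z \<in> unfold_diag ?l (diag p)"
  proof (cases "?l \<le> z")
    case True
    then show ?thesis using unfold_diag_iff[OF sub, of z] by (simp add: diag_def)
  next
    case False
    then have "2 * ?l - 1 - z = ?l + (?l - 1 - z)" by simp
    then show ?thesis using unfold_diag_iff[OF sub, of z] sym[of z] False by (simp add: diag_def)
  qed
qed

lemma sum_list_eq_sum_diag:
  assumes p: "is_partition p" "self_conjugate p"
  shows "sum_list p = (\<Sum>x\<in>diag p. 2 * x + 1)"
proof -
  have "diag p \<subseteq> {..<length p}" using diag_less_length[OF p] by auto
  from sum_unfold_diag[OF this] show ?thesis using sum_beta[OF p(1)] beta_eq_unfold_diag[OF p] by simp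
qed

text \<open>The diagonal determines the length, because \<open>0\<close> is never a first-column hook length.\<close>
lemma length_eq_diag:
  assumes p: "is_partition p" "self_conjugate p"
  shows "length p = (if diag p = {} then 0 else Suc (Max (diag p)))"
proof (cases "length p")
  case 0
  then show ?thesis by (simp add: diag_def)
next
  case (Suc l)
  have "diag p \<subseteq> {..<length p}" using diag_less_length[OF p] by auto
  then have "l \<in> diag p"
    using zero_notin_beta[OF p(1)] beta_eq_unfold_diag[OF p] unfold_diag_iff[of "diag p" "length p" 0] Suc by simp
  moreover have "Max (diag p) = l"
    by (rule Max_eqI) (use finite_diag diag_less_length[OF p] Suc \<open>l \<in> diag p\<close> in fastforce)+
  ultimately show ?thesis using Suc by auto
qed

lemma inj_on_diag: "inj_on diag {p. is_partition p \<and> self_conjugate p}"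
proof (rule inj_onI)
  fix p q assume pq: "p \<in> {p. is_partition p \<and> self_conjugate p}"
    "q \<in> {p. is_partition p \<and> self_conjugate p}" "diag p = diag q"
  then have "length p = length q" using length_eq_diag[of p] length_eq_diag[of q] by simp
  then have "beta p = beta q" using pq beta_eq_unfold_diag[of p] beta_eq_unfold_diag[of q] by simp
  then show "p = q" using inj_onD[OF inj_on_beta] pq by simp
qed

text \<open>The core condition, closure of \<open>unfold_diag l P\<close> under subtracting \<open>n\<close>, in terms of \<open>P\<close>. Subtracting
  \<open>n\<close> from \<open>l + x\<close> with \<open>x < n\<close> gives \<open>l - 1 - (n - 1 - x)\<close>, which explains
  the second alternative.\<close>
definition diag_closed :: "nat \<Rightarrow> nat set \<Rightarrow> bool" where
  "diag_closed n P \<longleftrightarrow> (\<forall>x\<in>P. if n \<le> x then x - n \<in> P else n - 1 - x \<notin> P)"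

lemma diag_image_self_conjugate_cores:
  assumes n: "n > 0"
  shows "diag ` self_conjugate_cores n (2 * n * e) = {P. P \<subseteq> {..<n * e} \<and> diag_closed n P}"
proof (intro equalityI subsetI)
  fix P assume "P \<in> diag ` self_conjugate_cores n (2 * n * e)"
  then obtain p where p: "is_partition p" "self_conjugate p" "is_core n p" "perimeter p \<le> 2 * n * e"
    and P: "P = diag p" by (auto simp: self_conjugate_cores_def)
  let ?l = "length p"
  have sub: "diag p \<subseteq> {..<?l}" using diag_less_length[OF p(1,2)] by auto
  have core: "h - n \<in> beta p" if "h \<in> beta p" "n \<le> h" for h
    using is_core_iff[OF p(1) n] p(3) that by blast
  have "x < n * e" if x: "x \<in> P" for x
  proof -
    have l: "0 < ?l" using x P diag_less_length[OF p(1,2)] by fastforce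
    have sym: "w \<in> beta p \<longleftrightarrow> 2 * ?l - 1 - w \<notin> beta p" if "w < 2 * ?l" for w
      using self_conjugate_iff[OF p(1)] p(2) that by blast
    \<comment> \<open>The reflection of \<open>0\<close> is a first-column hook length, so the perimeter bounds \<open>length p\<close>.\<close>
    have "2 * ?l - 1 \<in> beta p" using sym[of 0] l zero_notin_beta[OF p(1)] by simp
    moreover have "beta p \<subseteq> {..2 * n * e}" using perimeter_le_iff[OF p(1)] p(4) by simp
    ultimately have "2 * ?l - 1 \<le> 2 * (n * e)" by (auto simp: mult.assoc)
    moreover have "x < ?l" using x P sub by auto
    ultimately show ?thesis by linarith
  qed
  moreover have "diag_closed n P"
    unfolding diag_closed_def
  proof
    fix x assume x: "x \<in> P"
    then have x': "?l + x \<in> beta p" by (simp add: P diag_def)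
    show "if n \<le> x then x - n \<in> P else n - 1 - x \<notin> P"
    proof (cases "n \<le> x")
      case True
      then show ?thesis using core[OF x'] by (simp add: P diag_def)
    next
      case False
      have "n - 1 - x \<notin> P"
      proof
        assume y: "n - 1 - x \<in> P"
        then have "n - 1 - x < ?l" using sub P by auto
        then have *: "n \<le> ?l + x" "?l + x - n < ?l" "?l - 1 - (?l + x - n) = n - 1 - x"
          using False by auto
        then have "n - 1 - x \<notin> diag p"
          using core[OF x'] unfold_diag_iff[OF sub, of "?l + x - n"] beta_eq_unfold_diag[OF p(1,2)] by auto
        then show False using y P by simp
      qed
      then show ?thesis using False by simp
    qed
  qed
  ultimately show "P \<in> {P. P \<subseteq> {..<n * e} \<and> diag_closed n P}" by auto
next
  fix P assume "P \<in> {P. P \<subseteq> {..<n * e} \<and> diag_closed n P}"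
  then have P: "P \<subseteq> {..<n * e}" and closed: "diag_closed n P" by auto
  have fin: "finite P" using P by (rule finite_subset) simp
  define l where "l = (if P = {} then 0 else Suc (Max P))"
  have sub: "P \<subseteq> {..<l}" using fin by (auto simp: l_def less_Suc_eq_le)
  have l_le: "l \<le> n * e" using P fin Max_in[of P] by (auto simp: l_def Suc_le_eq)
  have top: "0 < l \<Longrightarrow> l - 1 \<in> P" using fin Max_in[of P] by (auto simp: l_def split: if_splits)
  note mem = unfold_diag_iff[OF sub]
  have "finite (unfold_diag l P)" by (simp add: unfold_diag_def)
  moreover have "0 \<notin> unfold_diag l P"
  proof (cases "l = 0")
    case False
    then show ?thesis using top mem[of 0] by simp
  qed (simp add: unfold_diag_def)
  ultimately obtain p where p: "is_partition p" "beta p = unfold_diag l P"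
    using ex_partition_beta by blast
  have len: "length p = l" using card_beta[OF p(1)] p(2) by (simp add: card_unfold_diag)
  have less: "unfold_diag l P \<subseteq> {..<2 * l}" using sub by (auto simp: unfold_diag_def)
  have sc: "self_conjugate p"
    unfolding self_conjugate_iff[OF p(1)] len p(2)
  proof (intro conjI less allI impI)
    fix z assume z: "z < 2 * l"
    show "z \<in> unfold_diag l P \<longleftrightarrow> 2 * l - 1 - z \<notin> unfold_diag l P"
    proof (cases "l \<le> z")
      case True
      then have "\<not> l \<le> 2 * l - 1 - z" "l - 1 - (2 * l - 1 - z) = z - l" using z by auto
      then show ?thesis using True mem[of z] mem[of "2 * l - 1 - z"] by simp
    next
      case False
      then have "l \<le> 2 * l - 1 - z" "2 * l - 1 - z - l = l - 1 - z" by auto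
      then show ?thesis using False mem[of z] mem[of "2 * l - 1 - z"] by simp
    qed
  qed
  have core: "is_core n p"
    unfolding is_core_iff[OF p(1) n] p(2)
  proof (intro ballI impI)
    fix z assume z: "z \<in> unfold_diag l P" "n \<le> z"
    have cl: "if n \<le> x then x - n \<in> P else n - 1 - x \<notin> P" if "x \<in> P" for x
      using closed that unfolding diag_closed_def by blast
    consider "l + n \<le> z" | "l \<le> z" "z < l + n" | "z < l" by linarith
    then show "z - n \<in> unfold_diag l P"
    proof cases
      case 1
      then have "z - l \<in> P" "n \<le> z - l" using mem[of z] z by auto
      then have "z - l - n \<in> P" using cl by metis
      moreover have "z - l - n = z - n - l" "l \<le> z - n" using 1 by auto
      ultimately show ?thesis using mem[of "z - n"] by simp
    next
      case 2
      then have "z - l \<in> P" "\<not> n \<le> z - l" using mem[of z] z by auto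
      then have "n - 1 - (z - l) \<notin> P" using cl by metis
      moreover have "n - 1 - (z - l) = l - 1 - (z - n)" "\<not> l \<le> z - n" using 2 z n by auto
      ultimately show ?thesis using mem[of "z - n"] by simp
    next
      case 3
      then have "l - 1 - z \<notin> P" using mem[of z] z by simp
      moreover have "n \<le> l - 1 - (z - n)" "l - 1 - (z - n) - n = l - 1 - z" "\<not> l \<le> z - n"
        using 3 z by auto
      ultimately have "l - 1 - (z - n) \<notin> P" using cl[of "l - 1 - (z - n)"] by metis
      then show ?thesis using mem[of "z - n"] \<open>\<not> l \<le> z - n\<close> by simp
    qed
  qed
  have "beta p \<subseteq> {..2 * n * e}" using less l_le unfolding p(2) by fastforce
  then have "p \<in> self_conjugate_cores n (2 * n * e)"
    using p(1) sc core perimeter_le_iff[OF p(1)] by (simp add: self_conjugate_cores_def)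
  moreover have "diag p = P"
    using mem unfolding diag_def len p(2) by auto
  ultimately show "P \<in> diag ` self_conjugate_cores n (2 * n * e)" by blast
qed

text \<open>The letter \<open>v\<close> encodes an integer between \<open>- e\<close> and \<open>e\<close>: up to \<open>e\<close> it counts the elements in the class
  of \<open>r\<close>, and \<open>v > e\<close> stands for \<open>v - e\<close> elements in the class of \<open>n - 1 - r\<close>.\<close>
definition signed_prog :: "nat \<Rightarrow> nat \<Rightarrow> nat \<Rightarrow> nat \<Rightarrow> nat set" where
  "signed_prog n e r v = (if v \<le> e then prog n r v else prog n (n - 1 - r) (v - e))"

text \<open>The set of diagonal arm lengths encoded by \<open>xs\<close>, where position \<open>r\<close> governs the classes of \<open>r\<close> and \<open>n - 1 - r\<close>.\<close>
definition signed_beads :: "nat \<Rightarrow> nat \<Rightarrow> nat list \<Rightarrow> nat set" where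
  "signed_beads n e xs = union_along (signed_prog n e) 0 xs"

lemma signed_beads_low_iff:
  assumes "length xs = n div 2" "r < n div 2" "x mod n = r"
  shows "x \<in> signed_beads n e xs \<longleftrightarrow> xs ! r \<le> e \<and> x div n < xs ! r"
proof
  assume "x \<in> signed_beads n e xs"
  then obtain i where i: "i < n div 2" "x \<in> signed_prog n e i (xs ! i)"
    using assms by (auto simp: signed_beads_def union_along_iff)
  then have "n - 1 - i \<noteq> r" using assms by linarith
  then show "xs ! r \<le> e \<and> x div n < xs ! r"
    using i assms by (auto simp: signed_prog_def prog_def split: if_splits)
qed (use assms in \<open>auto simp: signed_beads_def union_along_iff signed_prog_def prog_def intro!: exI[of _ r]\<close>)

lemma signed_beads_high_iff:
  assumes "length xs = n div 2" "r < n div 2" "x mod n = n - 1 - r"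
  shows "x \<in> signed_beads n e xs \<longleftrightarrow> e < xs ! r \<and> x div n < xs ! r - e"
proof
  assume "x \<in> signed_beads n e xs"
  then obtain i where i: "i < n div 2" "x \<in> signed_prog n e i (xs ! i)"
    using assms by (auto simp: signed_beads_def union_along_iff)
  then have "n - 1 - r \<noteq> i" "n - 1 - r = n - 1 - i \<Longrightarrow> i = r" using assms by linarith+
  then show "e < xs ! r \<and> x div n < xs ! r - e"
    using i assms by (auto simp: signed_prog_def prog_def split: if_splits)
qed (use assms in \<open>auto simp: signed_beads_def union_along_iff signed_prog_def prog_def intro!: exI[of _ r]\<close>)

lemma signed_beads_middle:
  assumes "length xs = n div 2" "\<not> x mod n < n div 2" "\<not> n - 1 - x mod n < n div 2" "n > 0"
  shows "x \<notin> signed_beads n e xs"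
proof
  assume "x \<in> signed_beads n e xs"
  then obtain i where i: "i < n div 2" "x \<in> signed_prog n e i (xs ! i)"
    using assms by (auto simp: signed_beads_def union_along_iff)
  then have "x mod n = i \<or> x mod n = n - 1 - i"
    by (auto simp: signed_prog_def prog_def split: if_splits)
  then show False using i assms by auto
qed

text \<open>The residues pair up as \<open>r\<close> and \<open>n - 1 - r\<close>; for odd \<open>n\<close> the middle one is its own partner, and its class
  is empty in every set that satisfies \<open>diag_closed\<close>.\<close>
lemma residue_cases:
  fixes s n :: nat
  assumes "s < n"
  obtains (low) "s < n div 2"
    | (high) r where "r < n div 2" "s = n - 1 - r"
    | (middle) "\<not> s < n div 2" "\<not> n - 1 - s < n div 2" "s = n - 1 - s"
proof -
  consider "s < n div 2" | "n - 1 - s < n div 2" | "\<not> s < n div 2" "\<not> n - 1 - s < n div 2"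
    by blast
  then show ?thesis
  proof cases
    case 1
    then show ?thesis by (rule low)
  next
    case 2
    moreover have "s = n - 1 - (n - 1 - s)" using assms by simp
    ultimately show ?thesis by (rule high)
  next
    case 3
    moreover from 3 assms have "s = n - 1 - s" by linarith
    ultimately show ?thesis by (rule middle)
  qed
qed

lemma inj_on_signed_beads: "inj_on (signed_beads n e) {xs. length xs = n div 2}"
proof (rule inj_onI)
  fix xs ys assume xy: "xs \<in> {xs. length xs = n div 2}" "ys \<in> {xs. length xs = n div 2}"
    "signed_beads n e xs = signed_beads n e ys"
  have "xs ! r = ys ! r" if r: "r < n div 2" for r
  proof -
    have rn: "r < n" "n - 1 - r < n" using r by auto
    have low: "xs ! r \<le> e \<and> k < xs ! r \<longleftrightarrow> ys ! r \<le> e \<and> k < ys ! r" for k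
      using signed_beads_low_iff[of xs n r "r + n * k" e] signed_beads_low_iff[of ys n r "r + n * k" e]
        xy r rn by simp
    have high: "e < xs ! r \<and> k < xs ! r - e \<longleftrightarrow> e < ys ! r \<and> k < ys ! r - e" for k
      using signed_beads_high_iff[of xs n r "(n - 1 - r) + n * k" e]
        signed_beads_high_iff[of ys n r "(n - 1 - r) + n * k" e] xy r rn
      by (simp only: mem_Collect_eq mod_mult_self2 div_mult_self2 mod_less div_less) auto
    consider "xs ! r \<le> e" "ys ! r \<le> e" | "e < xs ! r" "e < ys ! r"
      | "xs ! r \<le> e" "e < ys ! r" | "e < xs ! r" "ys ! r \<le> e" by linarith
    then show ?thesis
    proof cases
      case 1
      then show ?thesis using low[of "xs ! r"] low[of "ys ! r"] by auto
    next
      case 2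
      then show ?thesis using high[of "xs ! r - e"] high[of "ys ! r - e"] by auto
    qed (use high[of 0] in auto)
  qed
  then show "xs = ys" using xy by (intro nth_equalityI) auto
qed

lemma diag_closed_signed_beads:
  assumes len: "length xs = n div 2" and n: "n > 0"
  shows "diag_closed n (signed_beads n e xs)"
  unfolding diag_closed_def
proof
  fix x assume x: "x \<in> signed_beads n e xs"
  have sn: "x mod n < n" using n by simp
  show "if n \<le> x then x - n \<in> signed_beads n e xs else n - 1 - x \<notin> signed_beads n e xs"
  proof (cases "n \<le> x")
    case True
    then have *: "(x - n) mod n = x mod n" "(x - n) div n \<le> x div n"
      by (auto simp: le_mod_geq intro: div_le_mono)
    show ?thesis using sn
    proof (cases rule: residue_cases)
      case low
      then show ?thesis
        using signed_beads_low_iff[OF len low, of x e] signed_beads_low_iff[OF len low, of "x - n" e]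
          x * True by auto
    next
      case (high r)
      then show ?thesis
        using signed_beads_high_iff[OF len high(1), of x e]
          signed_beads_high_iff[OF len high(1), of "x - n" e] x * True by auto
    next
      case middle
      then show ?thesis using signed_beads_middle[OF len _ _ n] x by blast
    qed
  next
    case False
    then have xn: "x mod n = x" "(n - 1 - x) mod n = n - 1 - x" by auto
    have "n - 1 - x \<notin> signed_beads n e xs"
      using sn
    proof (cases rule: residue_cases)
      case low
      then show ?thesis
        using signed_beads_low_iff[OF len low, of x e]
          signed_beads_high_iff[OF len low, of "n - 1 - x" e] x xn by auto
    next
      case (high r)
      then have "n - 1 - x = r" using xn False by linarith
      then show ?thesis
        using signed_beads_high_iff[OF len high(1), of x e] high
          signed_beads_low_iff[OF len high(1), of "n - 1 - x" e] x xn by auto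
    next
      case middle
      then show ?thesis using signed_beads_middle[OF len _ _ n] x by blast
    qed
    then show ?thesis using False by simp
  qed
qed

lemma signed_prog_less:
  assumes "n > 0" "v \<le> 2 * e" "x \<in> signed_prog n e r v"
  shows "x < n * e"
proof -
  define c where "c = (if v \<le> e then v else v - e)"
  have "x < n * c"
    using assms prog_less[of n x r v] prog_less[of n x "n - 1 - r" "v - e"]
    by (auto simp: signed_prog_def c_def split: if_splits)
  moreover have "n * c \<le> n * e" using assms by (auto simp: c_def)
  ultimately show ?thesis by linarith
qed

lemma diag_closed_eq_image:
  assumes n: "n > 0"
  shows "{P. P \<subseteq> {..<n * e} \<and> diag_closed n P} = signed_beads n e ` words (2 * e) (n div 2)"
proof (intro equalityI subsetI)
  fix P assume "P \<in> signed_beads n e ` words (2 * e) (n div 2)"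
  then obtain xs where xs: "xs \<in> words (2 * e) (n div 2)" "P = signed_beads n e xs" by blast
  have len: "length xs = n div 2" using xs by (simp add: words_def)
  have "x < n * e" if x: "x \<in> P" for x
  proof -
    obtain i where i: "i < n div 2" "x \<in> signed_prog n e i (xs ! i)"
      using xs x len by (auto simp: signed_beads_def union_along_iff)
    then show ?thesis using signed_prog_less[OF n words_nth_le[OF xs(1)]] by simp
  qed
  then show "P \<in> {P. P \<subseteq> {..<n * e} \<and> diag_closed n P}"
    using diag_closed_signed_beads[OF len n] xs by auto
next
  fix P assume "P \<in> {P. P \<subseteq> {..<n * e} \<and> diag_closed n P}"
  then have P: "P \<subseteq> {..<n * e}" and closed: "diag_closed n P" by auto
  have fin: "finite P" using P by (rule finite_subset) simp
  have cl: "if n \<le> x then x - n \<in> P else n - 1 - x \<notin> P" if "x \<in> P" for x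
    using closed that unfolding diag_closed_def by blast
  have mem: "x \<in> P \<longleftrightarrow> x div n < runner n P (x mod n)" for x
    by (rule runner_iff[OF n fin]) (use cl in metis)
  have pos: "0 < runner n P s \<longleftrightarrow> s \<in> P" if "s < n" for s
    using mem[of s] that by simp
  have excl: "runner n P s = 0 \<or> runner n P (n - 1 - s) = 0" if "s < n" for s
    using pos[of s] pos[of "n - 1 - s"] cl[of s] that n by (metis diff_less_Suc
      gr0I leD less_Suc_eq_le Suc_pred' diff_le_self le_less_trans)
  have le: "runner n P s \<le> e" if s: "s < n" for s
  proof (rule ccontr)
    assume "\<not> runner n P s \<le> e"
    then have "s + n * e \<in> P" using mem[of "s + n * e"] s by simp
    then show False using P by auto
  qed
  define g where "g r = (if 0 < runner n P r then runner n P r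
      else if 0 < runner n P (n - 1 - r) then e + runner n P (n - 1 - r) else 0)" for r
  define xs where "xs = map g [0..<n div 2]"
  have len: "length xs = n div 2" by (simp add: xs_def)
  have nth: "xs ! r = g r" if "r < n div 2" for r using that by (simp add: xs_def)
  have "g r \<le> 2 * e" if "r < n div 2" for r
  proof -
    have "runner n P r \<le> e" "runner n P (n - 1 - r) \<le> e" using that by (auto intro!: le)
    then show ?thesis by (simp add: g_def)
  qed
  then have "xs \<in> words (2 * e) (n div 2)" by (auto simp: words_def xs_def)
  moreover have "x \<in> P \<longleftrightarrow> x \<in> signed_beads n e xs" for x
  proof -
    have "x mod n < n" using n by simp
    then show ?thesis
    proof (cases rule: residue_cases)
      case low
      then show ?thesis
        using signed_beads_low_iff[OF len low refl, of e] mem[of x] nth[OF low] le[of "x mod n"] n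
        by (auto simp: g_def)
    next
      case (high r)
      then have "r < n" by simp
      then show ?thesis
        using signed_beads_high_iff[OF len high, of e] mem[of x] nth[OF high(1)] high(2)
          excl[of r] le[of r] by (auto simp: g_def)
    next
      case middle
      then have "runner n P (x mod n) = 0" using excl[of "x mod n"] n by simp
      then show ?thesis using signed_beads_middle[OF len middle(1,2) n] mem[of x] by simp
    qed
  qed
  then have "P = signed_beads n e xs" by blast
  ultimately show "P \<in> signed_beads n e ` words (2 * e) (n div 2)" by blast
qed

section \<open>Bounded differences and concentration\<close>

lemma append_Cons_in_words_iff:
  "u @ c # w \<in> words d m \<longleftrightarrow> m = length u + Suc (length w) \<and> set u \<subseteq> {..d} \<and> c \<le> d \<and> set w \<subseteq> {..d}"
  by (auto simp: words_def)

lemma sum_list_words_le: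
  assumes "xs \<in> words d m"
  shows "sum_list xs \<le> m * d"
proof -
  have "set xs \<subseteq> {..d} \<Longrightarrow> sum_list xs \<le> length xs * d"
    by (induction xs) auto
  then show ?thesis using assms by (auto simp: words_def)
qed

lemma subgaussian_sum_along:
  assumes W: "\<And>i v. i < m \<Longrightarrow> v \<le> d \<Longrightarrow> real (W (j + i) v) \<le> b"
  shows "subgaussian (words d m) (\<lambda>xs. real (sum_along W j xs)) (real m * (b\<^sup>2 / 8))"
proof (rule subgaussian_words)
  fix u w c c' assume "u @ c # w \<in> words d m"
  then have "length u < m" "c \<le> d" by (simp_all add: append_Cons_in_words_iff)
  then show "real (sum_along W j (u @ c # w)) - real (sum_along W j (u @ c' # w)) \<le> b"
    using W[of "length u" c] by (simp add: sum_along_append)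
qed

lemma subgaussian_mono_dim:
  assumes "subgaussian A f (real m * v)" "m \<le> n" "0 \<le> v"
  shows "subgaussian A f (real n * v)"
  using assms(1) by (rule subgaussian_mono) (use assms(2,3) in \<open>simp add: mult_right_mono\<close>)

text \<open>The form in which the bounds are used: \<open>g\<close> maps the partitions and \<open>h\<close> the words bijectively to
  the same sets of numbers, and differences bounded by \<open>3 s\<close> yield the exponent \<open>- 2 r\<^sup>2 / (9 n s\<^sup>2)\<close>.\<close>
lemma deviation_prob_transfer:
  assumes fin: "finite A" "A \<noteq> {}" and g: "inj_on g A" and h: "inj_on h W" and img: "g ` A = h ` W"
    and X: "\<And>p. p \<in> A \<Longrightarrow> real (X p) = Y (g p)"
    and Z: "\<And>x. x \<in> W \<Longrightarrow> Y (h x) = Z x"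
    and sub: "subgaussian W Z (real n * ((3 * s)\<^sup>2 / 8))"
    and pos: "n > 0" "s > 0" "r > 0"
  shows "deviation_prob A X r \<le> 2 * exp (- (2 / 9) * (r\<^sup>2 / (real n * s\<^sup>2)))"
proof -
  let ?v = "real n * ((3 * s)\<^sup>2 / 8)"
  have "subgaussian W (\<lambda>x. Y (h x)) ?v" using sub subgaussian_cong[of W "\<lambda>x. Y (h x)" Z] Z by simp
  then have "subgaussian (g ` A) Y ?v" by (simp add: img subgaussian_image[OF h])
  then have "subgaussian A (\<lambda>p. Y (g p)) ?v" by (simp add: subgaussian_image[OF g])
  then have "subgaussian A (\<lambda>p. real (X p)) ?v"
    using subgaussian_cong[of A "\<lambda>p. real (X p)" "\<lambda>p. Y (g p)"] X by simp
  moreover have "?v > 0" using pos by simp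
  ultimately have "deviation_prob A X r \<le> 2 * exp (- (r\<^sup>2 / (4 * ?v)))"
    using deviation_prob_le fin pos(3) by blast
  also have "r\<^sup>2 / (4 * ?v) = (2 / 9) * (r\<^sup>2 / (real n * s\<^sup>2))"
    by (simp add: power_mult_distrib)
  finally show ?thesis by simp
qed

text \<open>The sum of the elements of the set encoded by \<open>xs\<close> when the first letter belongs to the class of \<open>j\<close>.\<close>
definition bead_sum :: "nat \<Rightarrow> nat \<Rightarrow> nat list \<Rightarrow> nat" where
  "bead_sum n j xs = sum_along (\<lambda>j c. \<Sum>k<c. j + n * k) j xs"

lemma prog_disjoint: "i < i' \<Longrightarrow> prog n i c \<inter> prog n i' c' = {}"
  by (auto simp: prog_def)

lemma card_beads:
  assumes "length xs = n - 1"
  shows "card (beads n xs) = sum_list xs"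
proof -
  have "card (beads n xs) = (\<Sum>x\<in>beads n xs. 1)" by simp
  also have "\<dots> = sum_along (\<lambda>i c. \<Sum>x\<in>prog n i c. 1) 1 xs"
    unfolding beads_def using assms by (intro sum_union_along prog_disjoint finite_prog) auto
  also have "\<dots> = sum_along (\<lambda>_ c. c) 1 xs"
    using assms by (intro sum_along_cong) (auto simp: card_prog)
  finally show ?thesis by (simp add: sum_along_const)
qed

lemma sum_beads:
  assumes "length xs = n - 1"
  shows "\<Sum>(beads n xs) = bead_sum n 1 xs"
proof -
  have "\<Sum>(beads n xs) = sum_along (\<lambda>i c. \<Sum>(prog n i c)) 1 xs"
    unfolding beads_def using assms by (intro sum_union_along prog_disjoint finite_prog) auto
  also have "\<dots> = bead_sum n 1 xs"
    unfolding bead_sum_def using assms by (intro sum_along_cong) (auto simp: sum_prog)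
  finally show ?thesis .
qed

lemma prog_sum_le:
  fixes j n c d :: nat
  assumes "j < n" "c \<le> d"
  shows "(\<Sum>k<c. j + n * k) \<le> n * d * d"
proof -
  have "(\<Sum>k<c. j + n * k) \<le> (\<Sum>k<c. n * d)"
  proof (rule sum_mono)
    fix k assume "k \<in> {..<c}"
    then have "Suc k \<le> d" using assms by simp
    then have "n * Suc k \<le> n * d" by (rule mult_le_mono2)
    then show "j + n * k \<le> n * d" using assms by simp
  qed
  also have "\<dots> = c * (n * d)" by simp
  also have "\<dots> \<le> d * (n * d)" using assms by (intro mult_le_mono1)
  finally show ?thesis by (simp add: mult_ac)
qed

lemma real_triangle: "real (\<Sum>{..<L}) = real L * (real L - 1) / 2"
  by (induction L) (auto simp: field_simps lessThan_Suc)

lemma triangle_diff_le: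
  assumes "L \<le> N" "L' \<le> N"
  shows "\<bar>real (\<Sum>{..<L}) - real (\<Sum>{..<L'})\<bar> \<le> \<bar>real L - real L'\<bar> * real N"
proof (cases "L = L'")
  case False
  have "real (\<Sum>{..<L}) - real (\<Sum>{..<L'}) = (real L - real L') * ((real L + real L' - 1) / 2)"
    unfolding real_triangle by (simp add: field_simps)
  moreover have "\<bar>(real L + real L' - 1) / 2\<bar> \<le> real N"
    using assms False by auto
  ultimately show ?thesis by (simp only: abs_mult) (intro mult_left_mono, auto)
qed simp

text \<open>The size of the core encoded by \<open>xs\<close>. The subtracted triangular number is quadratic in the length,
  but the length is at most \<open>n d\<close>, so it changes by at most \<open>n d\<^sup>2\<close> when the length changes by at most \<open>d\<close>.\<close>
definition core_size :: "nat \<Rightarrow> nat list \<Rightarrow> real" where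
  "core_size n xs = real (bead_sum n 1 xs) - real (\<Sum>{..<sum_list xs})"

lemma core_size_diff_le:
  assumes "xs \<in> words d (n - 1)" "ys \<in> words d (n - 1)"
    and "\<bar>real (bead_sum n 1 xs) - real (bead_sum n 1 ys)\<bar> \<le> 2 * (real n * (real d)\<^sup>2)"
    and "\<bar>real (sum_list xs) - real (sum_list ys)\<bar> \<le> real d"
  shows "\<bar>core_size n xs - core_size n ys\<bar> \<le> 3 * (real n * (real d)\<^sup>2)"
proof -
  have "sum_list zs \<le> n * d" if "zs \<in> words d (n - 1)" for zs
    by (rule order_trans[OF sum_list_words_le[OF that]]) simp
  then have "\<bar>real (\<Sum>{..<sum_list xs}) - real (\<Sum>{..<sum_list ys})\<bar>
      \<le> \<bar>real (sum_list xs) - real (sum_list ys)\<bar> * real (n * d)"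
    using assms by (intro triangle_diff_le) auto
  also have "\<dots> \<le> real d * real (n * d)" using assms by (intro mult_right_mono) auto
  also have "\<dots> = real n * (real d)\<^sup>2" by (simp add: power2_eq_square)
  finally show ?thesis using assms(3) unfolding core_size_def by linarith
qed

lemma bead_sum_append_Cons:
  "bead_sum n j (u @ c # w) =
     bead_sum n j u + (\<Sum>k<c. j + length u + n * k) + bead_sum n (Suc (j + length u)) w"
  by (simp add: bead_sum_def sum_along_append)

lemma core_size_coordinate:
  assumes u: "u @ c # w \<in> words d (n - 1)" "u @ c' # w \<in> words d (n - 1)"
  shows "core_size n (u @ c # w) - core_size n (u @ c' # w) \<le> 3 * (real n * (real d)\<^sup>2)"
proof -
  have len: "1 + length u < n" and c: "c \<le> d" "c' \<le> d"
    using u by (auto simp: append_Cons_in_words_iff)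
  have "(\<Sum>k<c. 1 + length u + n * k) \<le> n * d * d" "(\<Sum>k<c'. 1 + length u + n * k) \<le> n * d * d"
    using prog_sum_le[OF len] c by simp_all
  then have "\<bar>real (bead_sum n 1 (u @ c # w)) - real (bead_sum n 1 (u @ c' # w))\<bar> \<le> real (n * d * d)"
    unfolding bead_sum_append_Cons by linarith
  also have "\<dots> \<le> 2 * (real n * (real d)\<^sup>2)" by (simp add: power2_eq_square)
  finally have "\<bar>core_size n (u @ c # w) - core_size n (u @ c' # w)\<bar> \<le> 3 * (real n * (real d)\<^sup>2)"
    using u c by (intro core_size_diff_le) auto
  then show ?thesis by linarith
qed

lemma coupled_sum_list:
  assumes "coupled y x" "set x \<subseteq> {..d}"
  shows "sum_list y \<le> sum_list x" "sum_list x \<le> sum_list y + d"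
  using assms by (induction rule: coupled.induct) auto

lemma prog_sum_Suc: "(\<Sum>k<c. Suc j + n * k) = (\<Sum>k<c. j + n * k) + c"
  by (induction c) auto

text \<open>Moving the letter \<open>c\<close> to the next class adds \<open>1\<close> to each of its \<open>c\<close> elements; the letter that
  \<open>x\<close> may have in excess contributes at most \<open>n d\<^sup>2\<close>.\<close>
lemma coupled_bead_sum:
  assumes "coupled y x" "set x \<subseteq> {..d}" "j + length x \<le> n"
  shows "bead_sum n j y \<le> bead_sum n j x + sum_list y" "bead_sum n j x \<le> bead_sum n j y + n * d * d"
  using assms
proof (induction arbitrary: j rule: coupled.induct)
  case (coupled_single c)
  {
    case 1 show ?case by (simp add: bead_sum_def)
  next
    case 2 then show ?case using prog_sum_le[of j n c d] by (simp add: bead_sum_def)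
  }
next
  case (coupled_merge z c)
  {
    case 1 show ?case by (simp add: bead_sum_def)
  next
    case 2 then show ?case using prog_sum_le[of j n c d] by (simp add: bead_sum_def)
  }
next
  case (coupled_shift y x c)
  {
    case 1 then show ?case
      using coupled_shift.IH(1)[of "Suc (Suc j)"] prog_sum_Suc[of j n c] by (simp add: bead_sum_def)
  next
    case 2 then show ?case
      using coupled_shift.IH(2)[of "Suc (Suc j)"] prog_sum_Suc[of j n c] by (simp add: bead_sum_def)
  }
qed (simp_all add: bead_sum_def)

lemma core_size_coupled:
  assumes d: "d > 0" and w: "u @ 0 # x \<in> words d (n - 1)" "u @ c # y \<in> words d (n - 1)"
    and cp: "coupled y x"
  shows "\<bar>core_size n (u @ c # y) - core_size n (u @ 0 # x)\<bar> \<le> 3 * (real n * (real d)\<^sup>2)"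
    and "\<bar>real (sum_list (u @ c # y)) - real (sum_list (u @ 0 # x))\<bar> \<le> real d"
proof -
  have len: "Suc (1 + length u) + length x \<le> n" and c: "c \<le> d" and x: "set x \<subseteq> {..d}"
    using w by (auto simp: append_Cons_in_words_iff)
  show sum: "\<bar>real (sum_list (u @ c # y)) - real (sum_list (u @ 0 # x))\<bar> \<le> real d"
    using coupled_sum_list[OF cp x] c by simp
  have "sum_list y \<le> sum_list (u @ c # y)" by simp
  also have "\<dots> \<le> (n - 1) * d" by (rule sum_list_words_le[OF w(2)])
  also have "\<dots> \<le> (n * d) * d"
  proof (rule mult_le_mono1)
    have "n * 1 \<le> n * d" using d by (intro mult_le_mono2) simp
    then show "n - 1 \<le> n * d" by linarith
  qed
  finally have "sum_list y \<le> n * d * d" .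
  moreover have "(\<Sum>k<c. 1 + length u + n * k) \<le> n * d * d"
    using len c prog_sum_le[of "1 + length u" n c d] by simp
  ultimately have "\<bar>real (bead_sum n 1 (u @ c # y)) - real (bead_sum n 1 (u @ 0 # x))\<bar> \<le> 2 * real (n * d * d)"
    using coupled_bead_sum[OF cp x len] unfolding bead_sum_append_Cons lessThan_0 sum.empty by linarith
  also have "\<dots> = 2 * (real n * (real d)\<^sup>2)" by (simp add: power2_eq_square)
  finally show "\<bar>core_size n (u @ c # y) - core_size n (u @ 0 # x)\<bar> \<le> 3 * (real n * (real d)\<^sup>2)"
    using w sum by (intro core_size_diff_le) auto
qed

lemma sum_list_eq_beta:
  assumes p: "is_partition p"
  shows "real (sum_list p) = real (\<Sum>(beta p)) - real (\<Sum>{..<card (beta p)})"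
  using sum_beta[OF p] card_beta[OF p] by simp

lemma sum_list_coordinate:
  assumes "u @ c # w \<in> words d m"
  shows "real (sum_list (u @ c # w)) - real (sum_list (u @ c' # w)) \<le> 3 * real d"
  using assms by (simp add: append_Cons_in_words_iff)

lemma core_deviation:
  assumes pos: "n > 0" "d > 0" "r > 0"
  shows "deviation_prob (cores n (n * d)) length r \<le> 2 * exp (- (2 / 9) * (r\<^sup>2 / (real n * (real d)\<^sup>2)))"
    and "deviation_prob (cores n (n * d)) sum_list r
           \<le> 2 * exp (- (2 / 9) * (r\<^sup>2 / (real n * (real n * (real d)\<^sup>2)\<^sup>2)))"
proof -
  let ?A = "cores n (n * d)" and ?W = "words d (n - 1)"
  have A: "finite ?A" "?A \<noteq> {}" using finite_cores Nil_in_cores by blast+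
  have inj: "inj_on beta ?A" by (rule inj_on_subset[OF inj_on_beta]) (auto simp: cores_def)
  have injW: "inj_on (beads n) ?W" by (rule inj_on_subset[OF inj_on_beads]) (auto simp: words_def)
  note img = beta_image_cores[OF pos(1), of d]
  show "deviation_prob ?A length r \<le> 2 * exp (- (2 / 9) * (r\<^sup>2 / (real n * (real d)\<^sup>2)))"
  proof (rule deviation_prob_transfer[OF A inj injW img, where Y = "\<lambda>H. real (card H)"
        and Z = "\<lambda>xs. real (sum_list xs)"])
    show "subgaussian ?W (\<lambda>xs. real (sum_list xs)) (real n * ((3 * real d)\<^sup>2 / 8))"
      by (rule subgaussian_mono_dim, rule subgaussian_words, erule sum_list_coordinate) auto
  qed (use pos in \<open>auto simp: cores_def card_beta words_def card_beads\<close>)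
  show "deviation_prob ?A sum_list r \<le> 2 * exp (- (2 / 9) * (r\<^sup>2 / (real n * (real n * (real d)\<^sup>2)\<^sup>2)))"
  proof (rule deviation_prob_transfer[OF A inj injW img, where
        Y = "\<lambda>H. real (\<Sum>H) - real (\<Sum>{..<card H})" and Z = "core_size n"])
    show "subgaussian ?W (core_size n) (real n * ((3 * (real n * (real d)\<^sup>2))\<^sup>2 / 8))"
      by (rule subgaussian_mono_dim, rule subgaussian_words, erule core_size_coordinate) auto
  qed (use pos sum_list_eq_beta in \<open>auto simp: cores_def words_def card_beads sum_beads core_size_def\<close>)
qed

lemma strict_core_deviation:
  assumes pos: "n > 0" "d > 0" "r > 0"
  shows "deviation_prob (strict_cores n (n * d)) length r
           \<le> 2 * exp (- (2 / 9) * (r\<^sup>2 / (real n * (real d)\<^sup>2)))"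
    and "deviation_prob (strict_cores n (n * d)) sum_list r
           \<le> 2 * exp (- (2 / 9) * (r\<^sup>2 / (real n * (real n * (real d)\<^sup>2)\<^sup>2)))"
proof -
  let ?A = "strict_cores n (n * d)" and ?W = "separated_words d (n - 1)"
  have A: "finite ?A" "?A \<noteq> {}" using finite_strict_cores Nil_in_cores by blast+
  have inj: "inj_on beta ?A"
    by (rule inj_on_subset[OF inj_on_beta]) (auto simp: strict_cores_eq cores_def)
  have W: "xs \<in> words d (n - 1)" if "xs \<in> ?W" for xs using that by (simp add: separated_words_def)
  have injW: "inj_on (beads n) ?W"
    by (rule inj_on_subset[OF inj_on_beads]) (use W in \<open>auto simp: words_def\<close>)
  note img = beta_image_strict_cores[OF pos(1), of d]
  show "deviation_prob ?A length r \<le> 2 * exp (- (2 / 9) * (r\<^sup>2 / (real n * (real d)\<^sup>2)))"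
  proof (rule deviation_prob_transfer[OF A inj injW img, where Y = "\<lambda>H. real (card H)"
        and Z = "\<lambda>xs. real (sum_list xs)"])
    have "subgaussian ?W (\<lambda>xs. real (sum_list xs)) (real (n - 1) * ((3 * real d)\<^sup>2 / 8))"
    proof (rule subgaussian_separated_words)
      fix u c x y assume *: "u @ 0 # x \<in> ?W" "u @ c # y \<in> ?W" "coupled y x"
      show "\<bar>real (sum_list (u @ c # y)) - real (sum_list (u @ 0 # x))\<bar> \<le> 3 * real d"
        using core_size_coupled(2)[OF pos(2) W[OF *(1)] W[OF *(2)] *(3)] by linarith
    qed (rule sum_list_coordinate[OF W])
    then show "subgaussian ?W (\<lambda>xs. real (sum_list xs)) (real n * ((3 * real d)\<^sup>2 / 8))"
      by (rule subgaussian_mono_dim) auto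
  qed (use pos W in \<open>auto simp: strict_cores_eq cores_def card_beta words_def card_beads\<close>)
  show "deviation_prob ?A sum_list r \<le> 2 * exp (- (2 / 9) * (r\<^sup>2 / (real n * (real n * (real d)\<^sup>2)\<^sup>2)))"
  proof (rule deviation_prob_transfer[OF A inj injW img, where
        Y = "\<lambda>H. real (\<Sum>H) - real (\<Sum>{..<card H})" and Z = "core_size n"])
    have "subgaussian ?W (core_size n) (real (n - 1) * ((3 * (real n * (real d)\<^sup>2))\<^sup>2 / 8))"
    proof (rule subgaussian_separated_words)
      fix u c c' w assume "u @ c # w \<in> ?W" "u @ c' # w \<in> ?W"
      then show "core_size n (u @ c # w) - core_size n (u @ c' # w) \<le> 3 * (real n * (real d)\<^sup>2)"
        by (intro core_size_coordinate W)
    next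
      fix u c x y assume "u @ 0 # x \<in> ?W" "u @ c # y \<in> ?W" "coupled y x"
      then show "\<bar>core_size n (u @ c # y) - core_size n (u @ 0 # x)\<bar> \<le> 3 * (real n * (real d)\<^sup>2)"
        by (intro core_size_coupled(1) pos(2) W)
    qed
    then show "subgaussian ?W (core_size n) (real n * ((3 * (real n * (real d)\<^sup>2))\<^sup>2 / 8))"
      by (rule subgaussian_mono_dim) auto
  qed (use pos sum_list_eq_beta W in
      \<open>auto simp: strict_cores_eq cores_def words_def card_beads sum_beads core_size_def\<close>)
qed

lemma finite_signed_prog: "r < n \<Longrightarrow> finite (signed_prog n e r v)"
  by (simp add: signed_prog_def finite_prog)

lemma card_signed_prog_le: "r < n \<Longrightarrow> v \<le> 2 * e \<Longrightarrow> card (signed_prog n e r v) \<le> e"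
  by (auto simp: signed_prog_def card_prog)

lemma signed_prog_disjoint:
  "i < i' \<Longrightarrow> i' < n div 2 \<Longrightarrow> signed_prog n e i v \<inter> signed_prog n e i' v' = {}"
  by (auto simp: signed_prog_def prog_def)

lemma sum_signed_beads:
  assumes "length xs = n div 2"
  shows "(\<Sum>x\<in>signed_beads n e xs. f x) = sum_along (\<lambda>i v. \<Sum>x\<in>signed_prog n e i v. f x) 0 xs"
  unfolding signed_beads_def using assms by (intro sum_union_along finite_signed_prog signed_prog_disjoint) auto

lemma self_conjugate_core_deviation:
  assumes pos: "n > 0" "e > 0" "r > 0"
  shows "deviation_prob (self_conjugate_cores n (2 * n * e)) durfee_length r
           \<le> 2 * exp (- (2 / 9) * (r\<^sup>2 / (real n * (real e)\<^sup>2)))"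
    and "deviation_prob (self_conjugate_cores n (2 * n * e)) sum_list r
           \<le> 2 * exp (- (2 / 9) * (r\<^sup>2 / (real n * (real n * (real e)\<^sup>2)\<^sup>2)))"
proof -
  let ?A = "self_conjugate_cores n (2 * n * e)" and ?W = "words (2 * e) (n div 2)"
  have A: "finite ?A" "?A \<noteq> {}" using finite_self_conjugate_cores Nil_in_cores by blast+
  have inj: "inj_on diag ?A"
    by (rule inj_on_subset[OF inj_on_diag]) (auto simp: self_conjugate_cores_def)
  have injW: "inj_on (signed_beads n e) ?W"
    by (rule inj_on_subset[OF inj_on_signed_beads]) (auto simp: words_def)
  have img: "diag ` ?A = signed_beads n e ` ?W"
    using diag_image_self_conjugate_cores[OF pos(1)] diag_closed_eq_image[OF pos(1)] by simp
  have general: "deviation_prob ?A X r \<le> 2 * exp (- (2 / 9) * (r\<^sup>2 / (real n * s\<^sup>2)))"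
    if X: "\<And>p. p \<in> ?A \<Longrightarrow> X p = (\<Sum>x\<in>diag p. f x)" and s: "s > 0"
      and f: "\<And>i v. i < n div 2 \<Longrightarrow> v \<le> 2 * e \<Longrightarrow> real (\<Sum>x\<in>signed_prog n e i v. f x) \<le> 3 * s"
    for X and f :: "nat \<Rightarrow> nat" and s
  proof (rule deviation_prob_transfer[OF A inj injW img, where Y = "\<lambda>P. real (\<Sum>x\<in>P. f x)"
        and Z = "\<lambda>xs. real (sum_along (\<lambda>i v. \<Sum>x\<in>signed_prog n e i v. f x) 0 xs)"])
    have "subgaussian ?W (\<lambda>xs. real (sum_along (\<lambda>i v. \<Sum>x\<in>signed_prog n e i v. f x) 0 xs))
        (real (n div 2) * ((3 * s)\<^sup>2 / 8))"
      by (rule subgaussian_sum_along) (use f in simp)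
    then show "subgaussian ?W (\<lambda>xs. real (sum_along (\<lambda>i v. \<Sum>x\<in>signed_prog n e i v. f x) 0 xs))
        (real n * ((3 * s)\<^sup>2 / 8))"
      by (rule subgaussian_mono_dim) auto
  qed (use pos s X in \<open>simp_all add: words_def sum_signed_beads\<close>)
  show "deviation_prob ?A durfee_length r \<le> 2 * exp (- (2 / 9) * (r\<^sup>2 / (real n * (real e)\<^sup>2)))"
  proof (rule general[where f = "\<lambda>_. 1"])
    fix i v assume "i < n div 2" "v \<le> 2 * e"
    then have "real (card (signed_prog n e i v)) \<le> real e"
      by (intro of_nat_mono card_signed_prog_le) auto
    then show "real (\<Sum>x\<in>signed_prog n e i v. 1) \<le> 3 * real e" by simp
  qed (use pos durfee_length_eq_card_diag in \<open>auto simp: self_conjugate_cores_def\<close>)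
  show "deviation_prob ?A sum_list r \<le> 2 * exp (- (2 / 9) * (r\<^sup>2 / (real n * (real n * (real e)\<^sup>2)\<^sup>2)))"
  proof (rule general[where f = "\<lambda>x. 2 * x + 1"])
    fix i v assume iv: "i < n div 2" "v \<le> 2 * e"
    have "(\<Sum>x\<in>signed_prog n e i v. 2 * x + 1) \<le> (\<Sum>x\<in>signed_prog n e i v. 2 * (n * e))"
      using signed_prog_less[OF pos(1) iv(2)] by (intro sum_mono) fastforce
    also have "\<dots> \<le> e * (2 * (n * e))"
      using card_signed_prog_le[of i n v e] iv by (simp add: mult_le_mono1)
    finally have "real (\<Sum>x\<in>signed_prog n e i v. 2 * x + 1) \<le> real (e * (2 * (n * e)))"
      by (simp only: of_nat_le_iff)
    also have "\<dots> \<le> 3 * (real n * (real e)\<^sup>2)" by (simp add: power2_eq_square)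
    finally show "real (\<Sum>x\<in>signed_prog n e i v. 2 * x + 1) \<le> 3 * (real n * (real e)\<^sup>2)" .
  qed (use pos sum_list_eq_sum_diag in \<open>auto simp: self_conjugate_cores_def\<close>)
qed

theorem theorem1p2:
  "\<exists>C::real. C > 0 \<and>
    (\<forall>(n::nat) (D::nat) (E::nat). n > 0 \<longrightarrow> D > 0 \<longrightarrow> n dvd D \<longrightarrow> E > 0 \<longrightarrow> 2 * n dvd E \<longrightarrow>
      (let d = real D / real n; e = real E / (2 * real n) in
        \<forall>r::real. r > 0 \<longrightarrow>
          deviation_prob (cores n D) length r \<le> 2 * exp (- C * (r\<^sup>2 / (real n * d\<^sup>2))) \<and>
          deviation_prob (cores n D) sum_list r \<le> 2 * exp (- C * (r\<^sup>2 / (real n ^ 3 * d ^ 4))) \<and>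
          deviation_prob (strict_cores n D) length r \<le> 2 * exp (- C * (r\<^sup>2 / (real n * d\<^sup>2))) \<and>
          deviation_prob (strict_cores n D) sum_list r \<le> 2 * exp (- C * (r\<^sup>2 / (real n ^ 3 * d ^ 4))) \<and>
          deviation_prob (self_conjugate_cores n E) durfee_length r \<le> 2 * exp (- C * (r\<^sup>2 / (real n * e\<^sup>2))) \<and>
          deviation_prob (self_conjugate_cores n E) sum_list r \<le> 2 * exp (- C * (r\<^sup>2 / (real n ^ 3 * e ^ 4)))))"
proof (intro exI[of _ "2 / 9"] conjI allI impI)
  fix n D E :: nat
  assume n: "n > 0" and "D > 0" "n dvd D" "E > 0" "2 * n dvd E"
  then obtain d e where D: "D = n * d" "d > 0" and E: "E = 2 * n * e" "e > 0"
    by (elim dvdE) auto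
  have scale: "real n * (real n * (real k)\<^sup>2)\<^sup>2 = real n ^ 3 * real k ^ 4" for k
    by (simp add: power_mult_distrib power2_eq_square power3_eq_cube power4_eq_xxxx)
  have "real D / real n = real d" "real E / (2 * real n) = real e" using n D E by simp_all
  then show "let d = real D / real n; e = real E / (2 * real n) in
        \<forall>r::real. r > 0 \<longrightarrow>
          deviation_prob (cores n D) length r \<le> 2 * exp (- (2 / 9) * (r\<^sup>2 / (real n * d\<^sup>2))) \<and>
          deviation_prob (cores n D) sum_list r \<le> 2 * exp (- (2 / 9) * (r\<^sup>2 / (real n ^ 3 * d ^ 4))) \<and>
          deviation_prob (strict_cores n D) length r \<le> 2 * exp (- (2 / 9) * (r\<^sup>2 / (real n * d\<^sup>2))) \<and>
          deviation_prob (strict_cores n D) sum_list r \<le> 2 * exp (- (2 / 9) * (r\<^sup>2 / (real n ^ 3 * d ^ 4))) \<and>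
          deviation_prob (self_conjugate_cores n E) durfee_length r \<le> 2 * exp (- (2 / 9) * (r\<^sup>2 / (real n * e\<^sup>2))) \<and>
          deviation_prob (self_conjugate_cores n E) sum_list r \<le> 2 * exp (- (2 / 9) * (r\<^sup>2 / (real n ^ 3 * e ^ 4)))"
    unfolding Let_def
    using core_deviation[OF n D(2), folded D(1), unfolded scale]
      strict_core_deviation[OF n D(2), folded D(1), unfolded scale]
      self_conjugate_core_deviation[OF n E(2), folded E(1), unfolded scale] by metis
qed simp

end
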